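(* Let $\mathbf{S}:=(\mathbf{FN}_5\{a,b\}/\theta)^1$, where $\theta$ is the congruence on $\mathbf{FN}_5\{a,b\}$ whose equivalence classes are $\{(ab)^2,(ba)^2\}$, $\{a^2b^2,b^2a^2\}$, and the rest singletons. Let $\mathbf{T}\cong(\mathbf{FN}_5\{a,b\})^1$ be such that $S$ and $T$ have only their zero element $0$ in common, i.e. $S\cap T=\{0\}$. Then: (1) the $0$-direct union $\mathbf{S}\mathbin{\mathring\cup}\mathbf{T}$ is finitely related; (2) $\mathbf{S}$ is a subsemigroup of $\mathbf{S}\mathbin{\mathring\cup}\mathbf{T}$ and is (isomorphic to) a Rees quotient of $\mathbf{S}\mathbin{\mathring\cup}\mathbf{T}$, but $\mathbf{S}$ is not finitely related.
   Context: For a nonempty set $A$, $\mathbf{A}^+$ is the free semigroup on $A$ (nonempty words over $A$ under concatenation). For an ideal $\mathbf{I}$ of a semigroup $\mathbf{S}$ (a subsemigroup with $si,is\in I$ for all $i\in I$, $s\in S$), the Rees quotient of $\mathbf{S}$ by $\mathbf{I}$ is the quotient of $\mathbf{S}$ by the congruence $(I\times I)\cup\{(s,s)\mid s\in S\}$. The free $d$-nilpotent semigroup $\mathbf{FN}_d A$ is the Rees quotient of $\mathbf{A}^+$ by the ideal of all words of length at least $d$. For a semigroup $\mathbf{N}$, $\mathbf{N}^1$ denotes $\mathbf{N}$ with an adjoined identity element $1$. For a semigroup $\mathbf{S}$, $\mathbf{S}^0$ is $\mathbf{S}$ itself if $\mathbf{S}$ has a zero element, and otherwise $\mathbf{S}$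 with an adjoined zero element. For semigroups $\mathbf{S},\mathbf{T}$ with $S^0\cap T^0=\{0\}$, the $0$-direct union $\mathbf{S}\mathbin{\mathring\cup}\mathbf{T}$ is the semigroup with universe $S^0\cup T^0$ in which $x\cdot y$ is the product in $\mathbf{S}^0$ if $x,y\in S^0$, the product in $\mathbf{T}^0$ if $x,y\in T^0$, and $0$ otherwise. A semigroup term $t(x_1,\dots,x_n)$ is a (nonempty) word in the alphabet $x_1,\dots,x_n$; monoids are considered here as semigroups, i.e. with multiplication as the only operation. The $n$-ary term functions of $\mathbf{S}$ are the functions $t^{\mathbf{S}}:S^n\to S$ induced by terms $t(x_1,\dots,x_n)$ by evaluation. A function $f:S^n\to S$ preserves a relation $R\subseteq S^k$ if $f(r_1,\dots,r_n)\in R$ (with $f$ applied componentwise) whenever $r_1,\dots,r_n\in R$. $\mathbf{S}$ is finitely related if there are finitely many finitary relations $R_1,\dots,R_m$ on $S$ such that the finitary term functions of $\mathbf{S}$ are precisely the finitary functions on $S$ that preserve $R_1,\dots,R_m$. *)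

theory Defs
  imports "HOL-Algebra.Congruence"
begin

section \<open>Semigroups with explicit carrier\<close>

record 'a semigrp = "'a partial_object" +
  smult :: "'a \<Rightarrow> 'a \<Rightarrow> 'a"  (infixl \<open>\<odot>\<index>\<close> 70)

locale is_semigroup =
  fixes S :: "'a semigrp" (structure)
  assumes nonempty: "carrier S \<noteq> {}"
    and m_closed: "\<lbrakk>x \<in> carrier S; y \<in> carrier S\<rbrakk> \<Longrightarrow> x \<odot> y \<in> carrier S"
    and m_assoc: "\<lbrakk>x \<in> carrier S; y \<in> carrier S; z \<in> carrier S\<rbrakk> \<Longrightarrow> (x \<odot> y) \<odot> z = x \<odot> (y \<odot> z)"

definition is_zero :: "'a semigrp \<Rightarrow> 'a \<Rightarrow> bool" where
  "is_zero S z \<longleftrightarrow> z \<in> carrier S \<and> (\<forall>x\<in>carrier S. x \<odot>\<^bsub>S\<^esub> z = z \<and> z \<odot>\<^bsub>S\<^esub> x = z)"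

definition subsemigroup :: "'a semigrp \<Rightarrow> 'a semigrp \<Rightarrow> bool" where
  "subsemigroup H S \<longleftrightarrow> carrier H \<noteq> {} \<and> carrier H \<subseteq> carrier S \<and>
     (\<forall>x\<in>carrier H. \<forall>y\<in>carrier H. x \<odot>\<^bsub>S\<^esub> y \<in> carrier H \<and> x \<odot>\<^bsub>H\<^esub> y = x \<odot>\<^bsub>S\<^esub> y)"

definition semigroup_iso :: "'a semigrp \<Rightarrow> 'b semigrp \<Rightarrow> ('a \<Rightarrow> 'b) set" where
  "semigroup_iso S T = {h. bij_betw h (carrier S) (carrier T) \<and>
     (\<forall>x\<in>carrier S. \<forall>y\<in>carrier S. h (x \<odot>\<^bsub>S\<^esub> y) = h x \<odot>\<^bsub>T\<^esub> h y)}"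

definition semigroup_isomorphic :: "'a semigrp \<Rightarrow> 'b semigrp \<Rightarrow> bool" where
  "semigroup_isomorphic S T \<longleftrightarrow> is_semigroup S \<and> is_semigroup T \<and> semigroup_iso S T \<noteq> {}"

text \<open>For a congruence \<open>r\<close> on \<open>S\<close>, the product below is the single class containing all
  products of representatives.\<close>

definition quotient_semigroup :: "'a semigrp \<Rightarrow> ('a \<times> 'a) set \<Rightarrow> 'a set semigrp" where
  "quotient_semigroup S r =
     \<lparr>carrier = carrier S // r,
      smult = (\<lambda>X Y. r `` {x \<odot>\<^bsub>S\<^esub> y | x y. x \<in> X \<and> y \<in> Y})\<rparr>"

definition is_ideal :: "'a set \<Rightarrow> 'a semigrp \<Rightarrow> bool" where
  "is_ideal I S \<longleftrightarrow> subsemigroup (S\<lparr>carrier := I\<rparr>) S \<and>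
     (\<forall>i\<in>I. \<forall>s\<in>carrier S. s \<odot>\<^bsub>S\<^esub> i \<in> I \<and> i \<odot>\<^bsub>S\<^esub> s \<in> I)"

definition rees_congruence :: "'a semigrp \<Rightarrow> 'a set \<Rightarrow> ('a \<times> 'a) set" where
  "rees_congruence S I = I \<times> I \<union> {(s, s) | s. s \<in> carrier S}"

definition rees_quotient :: "'a semigrp \<Rightarrow> 'a set \<Rightarrow> 'a set semigrp" where
  "rees_quotient S I = quotient_semigroup S (rees_congruence S I)"

text \<open>\<open>None\<close> is the new identity; it is adjoined even if \<open>N\<close> already has one.\<close>

definition adjoin_one :: "'a semigrp \<Rightarrow> 'a option semigrp" where
  "adjoin_one N =
     \<lparr>carrier = insert None (Some ` carrier N),
      smult = (\<lambda>x y. case (x, y) of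
          (None, _) \<Rightarrow> y
        | (_, None) \<Rightarrow> x
        | (Some u, Some v) \<Rightarrow> Some (u \<odot>\<^bsub>N\<^esub> v))\<rparr>"

text \<open>The semigroup \<open>S\<^sup>0\<close>; the point \<open>z\<close> serves as the new zero and is used only when
  \<open>S\<close> has no zero element.\<close>

definition with_zero :: "'a \<Rightarrow> 'a semigrp \<Rightarrow> 'a semigrp" where
  "with_zero z S =
     (if \<exists>u. is_zero S u then S
      else \<lparr>carrier = insert z (carrier S),
            smult = (\<lambda>x y. if x = z \<or> y = z then z else x \<odot>\<^bsub>S\<^esub> y)\<rparr>)"

text \<open>Meaningful when \<open>S\<^sup>0\<close> and \<open>T\<^sup>0\<close> have exactly the element \<open>z\<close> in common and \<open>z\<close> is
  the zero of both.\<close>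

definition zero_direct_union :: "'a \<Rightarrow> 'a semigrp \<Rightarrow> 'a semigrp \<Rightarrow> 'a semigrp" where
  "zero_direct_union z S T =
     \<lparr>carrier = carrier (with_zero z S) \<union> carrier (with_zero z T),
      smult = (\<lambda>x y.
        if x \<in> carrier (with_zero z S) \<and> y \<in> carrier (with_zero z S)
          then x \<odot>\<^bsub>with_zero z S\<^esub> y
        else if x \<in> carrier (with_zero z T) \<and> y \<in> carrier (with_zero z T)
          then x \<odot>\<^bsub>with_zero z T\<^esub> y
        else z)\<rparr>"


section \<open>Free semigroups and free nilpotent semigroups\<close>

definition free_semigroup :: "'a set \<Rightarrow> 'a list semigrp" where
  "free_semigroup A = \<lparr>carrier = {w. w \<noteq> [] \<and> set w \<subseteq> A}, smult = (@)\<rparr>"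

definition long_words :: "nat \<Rightarrow> 'a set \<Rightarrow> 'a list set" where
  "long_words d A = {w \<in> carrier (free_semigroup A). d \<le> length w}"

definition free_nilpotent :: "nat \<Rightarrow> 'a set \<Rightarrow> 'a list set semigrp" where
  "free_nilpotent d A = rees_quotient (free_semigroup A) (long_words d A)"

definition nil_class :: "nat \<Rightarrow> 'a set \<Rightarrow> 'a list \<Rightarrow> 'a list set" where
  "nil_class d A w = rees_congruence (free_semigroup A) (long_words d A) `` {w}"

text \<open>\<open>theta a b\<close> is given by its classes: the two in \<open>theta_pairs a b\<close> and all other singletons.
  For \<open>a \<noteq> b\<close> it is a congruence, since the words identified have length 4 and so have
  zero product with everything.\<close>

definition theta_pairs :: "'a \<Rightarrow> 'a \<Rightarrow> 'a list set set set" where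
  "theta_pairs a b =
     {{nil_class 5 {a, b} [a, b, a, b], nil_class 5 {a, b} [b, a, b, a]},
      {nil_class 5 {a, b} [a, a, b, b], nil_class 5 {a, b} [b, b, a, a]}}"

definition theta_classes :: "'a \<Rightarrow> 'a \<Rightarrow> 'a list set set set" where
  "theta_classes a b = theta_pairs a b \<union>
     {{x} | x. x \<in> carrier (free_nilpotent 5 {a, b}) - \<Union> (theta_pairs a b)}"

definition theta :: "'a \<Rightarrow> 'a \<Rightarrow> ('a list set \<times> 'a list set) set" where
  "theta a b = (\<Union>C\<in>theta_classes a b. C \<times> C)"


section \<open>Term functions and finite relatedness\<close>

text \<open>Elements of \<open>A\<^sup>n\<close> are lists of length \<open>n\<close>; \<open>n\<close>-ary functions on \<open>A\<close> are
  elements of \<open>tuples n A \<rightarrow>\<^sub>E A\<close>, that is, functions on lists that are \<open>undefined\<close>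
  outside \<open>tuples n A\<close>.\<close>

definition tuples :: "nat \<Rightarrow> 'a set \<Rightarrow> 'a list set" where
  "tuples n A = {xs. length xs = n \<and> set xs \<subseteq> A}"

fun word_product :: "'a semigrp \<Rightarrow> 'a list \<Rightarrow> 'a" where
  "word_product S [] = undefined"
| "word_product S [x] = x"
| "word_product S (x # y # ys) = x \<odot>\<^bsub>S\<^esub> word_product S (y # ys)"

text \<open>An \<open>n\<close>-ary term is a nonempty word \<open>t\<close> over \<open>{..<n}\<close>, the letter \<open>i\<close> standing for the
  \<open>i\<close>-th variable, counted from zero.\<close>

definition term_function :: "'a semigrp \<Rightarrow> nat \<Rightarrow> nat list \<Rightarrow> 'a list \<Rightarrow> 'a" where
  "term_function S n t =
     restrict (\<lambda>xs. word_product S (map (\<lambda>i. xs ! i) t)) (tuples n (carrier S))"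

definition term_functions :: "'a semigrp \<Rightarrow> nat \<Rightarrow> ('a list \<Rightarrow> 'a) set" where
  "term_functions S n = {term_function S n t | t. t \<noteq> [] \<and> set t \<subseteq> {..<n}}"

text \<open>Here \<open>f\<close> is \<open>n\<close>-ary and \<open>R\<close> is \<open>k\<close>-ary; \<open>rs = [r\<^sub>1, \<dots>, r\<^sub>n]\<close> is a list of \<open>n\<close>
  members of \<open>R\<close>.\<close>

definition preserves :: "nat \<Rightarrow> nat \<Rightarrow> ('a list \<Rightarrow> 'a) \<Rightarrow> 'a list set \<Rightarrow> bool" where
  "preserves n k f R \<longleftrightarrow>
     (\<forall>rs \<in> tuples n R. map (\<lambda>j. f (map (\<lambda>r. r ! j) rs)) [0..<k] \<in> R)"

text \<open>A finitary relation is given together with its arity. Operations and relations have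
  positive arity. Admitting arity zero would give the same notion, since nullary functions do
  not preserve the empty relation.\<close>

definition finitely_related :: "'a semigrp \<Rightarrow> bool" where
  "finitely_related S \<longleftrightarrow>
     (\<exists>\<R> :: (nat \<times> 'a list set) set. finite \<R> \<and>
        (\<forall>(k, R)\<in>\<R>. 1 \<le> k \<and> R \<subseteq> tuples k (carrier S)) \<and>
        (\<forall>n\<ge>1. term_functions S n =
           {f \<in> tuples n (carrier S) \<rightarrow>\<^sub>E carrier S. \<forall>(k, R)\<in>\<R>. preserves n k f R}))"

end

theory Submission
  imports Defs
begin

text \<open>
  Both monoids consist of values of words in two letters, so a term function is governed by the
  patterns in which its variables occur. In \<open>T\<close> a substitution that does not give zero sends all
  variables to the identity, except some with at most four occurrences altogether. Hence an identity
  holds in \<open>T\<close> iff both sides agree after every deletion of letters that leaves at most four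
  occurrences on one side (\<open>short_eq\<close>). The monoid \<open>S\<close> is a quotient of \<open>T\<close> and satisfies these
  identities too, and the zero-direct union \<open>U\<close> of both embeds into \<open>S \<times> T\<close> by the two
  retractions that collapse one part to zero. So \<open>U\<close> and \<open>T\<close> satisfy the same identities,
  although \<open>S\<close> satisfies more.

  \<^bold>\<open>Why \<open>U\<close> is finitely related.\<close> It suffices to find \<open>m\<close> such that an operation is a term function
  as soon as all operations arising from it by identifying its variables to at most \<open>m\<close> ones are
  (\<open>finitely_relatedI\<close>). The words of these minors prescribe the number of occurrences of every
  variable, counted up to five, and the relative order of the occurrences of any two variables that
  have at most four occurrences together. A word with these data must be found. Variables with one or
  two occurrences are pairwise comparable, a variable with three occurrences is comparable only to
  those with one, and all others are incomparable to everything. Therefore the word can be built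
  letter by letter, since agreement on triples of variables already guarantees that a possible first
  letter exists (\<open>coherent_first_letter\<close>, \<open>amalgamation\<close>). That the word so obtained induces the given
  operation is \<open>minors_amalgamate\<close>.

  \<^bold>\<open>Why \<open>S\<close> is not finitely related.\<close> The congruence \<open>\<theta>\<close> makes \<open>x y x y\<close> and \<open>x x y y\<close> symmetric
  in \<open>x\<close> and \<open>y\<close>. A word in which every variable occurs twice is seen by \<open>S\<close> as a family of intervals,
  one between the two occurrences of each variable, and \<open>S\<close> tells for two intervals whether they
  overlap, are disjoint or are nested, but in the first two cases not which one comes first. For \<open>n\<close>
  variables arranged in a cycle, prescribe that neighbours overlap and that all other pairs are
  disjoint. This defines an operation on \<open>S\<close>. Intervals on a line cannot realise a cycle of length
  \<open>n \<ge> 4\<close> (\<open>no_cycle_word\<close>), but they do realise a path, and identifying two variables has the effect of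
  deleting one vertex of the cycle (\<open>cycle_word_minor\<close>). So every minor is a term function while the
  operation itself is none, for arbitrarily large \<open>n\<close>, which is impossible over finitely many
  relations (\<open>finitely_related_arity_bound\<close>).
\<close>

section \<open>Congruences and Rees quotients\<close>

definition congruence :: "'s semigrp \<Rightarrow> ('s \<times> 's) set \<Rightarrow> bool" where
  "congruence S r \<longleftrightarrow> equiv (carrier S) r \<and>
     (\<forall>x x' y y'. (x, x') \<in> r \<longrightarrow> (y, y') \<in> r \<longrightarrow> (x \<odot>\<^bsub>S\<^esub> y, x' \<odot>\<^bsub>S\<^esub> y') \<in> r)"

lemma quotient_mult:
  assumes "congruence S r" "x \<in> carrier S" "y \<in> carrier S"
  shows "r `` {x} \<odot>\<^bsub>quotient_semigroup S r\<^esub> r `` {y} = r `` {x \<odot>\<^bsub>S\<^esub> y}"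
proof -
  have e: "equiv (carrier S) r"
    and c: "\<And>x x' y y'. (x, x') \<in> r \<Longrightarrow> (y, y') \<in> r \<Longrightarrow> (x \<odot>\<^bsub>S\<^esub> y, x' \<odot>\<^bsub>S\<^esub> y') \<in> r"
    using assms(1) by (auto simp: congruence_def)
  have refl: "(x, x) \<in> r" "(y, y) \<in> r" using e assms by (auto simp: equiv_def refl_on_def)
  have "trans r" using e by (auto simp: equiv_def)
  have "r `` {x' \<odot>\<^bsub>S\<^esub> y' | x' y'. x' \<in> r `` {x} \<and> y' \<in> r `` {y}} = r `` {x \<odot>\<^bsub>S\<^esub> y}" (is "?L = ?R")
  proof
    show "?L \<subseteq> ?R" using c transD[OF \<open>trans r\<close>] by blast
    show "?R \<subseteq> ?L" using refl by blast
  qed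
  then show ?thesis by (simp add: quotient_semigroup_def)
qed

lemma is_semigroup_quotient:
  assumes S: "is_semigroup S" and r: "congruence S r"
  shows "is_semigroup (quotient_semigroup S r)"
proof -
  interpret is_semigroup S by (rule S)
  have car: "carrier (quotient_semigroup S r) = (\<lambda>x. r `` {x}) ` carrier S"
    by (auto simp: quotient_semigroup_def quotient_def)
  show ?thesis
    by unfold_locales (auto simp: car nonempty quotient_mult[OF r] m_closed m_assoc)
qed

lemma rees_congruence_mem:
  "(x, y) \<in> rees_congruence S I \<longleftrightarrow> x \<in> I \<and> y \<in> I \<or> x = y \<and> x \<in> carrier S"
  by (auto simp: rees_congruence_def)

lemma congruence_rees:
  assumes S: "is_semigroup S" and I: "is_ideal I S"
  shows "congruence S (rees_congruence S I)"
proof -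
  interpret is_semigroup S by (rule S)
  have sub: "I \<subseteq> carrier S" using I by (auto simp: is_ideal_def subsemigroup_def)
  have ideal: "s \<odot>\<^bsub>S\<^esub> i \<in> I" "i \<odot>\<^bsub>S\<^esub> s \<in> I" if "i \<in> I" "s \<in> carrier S" for i s
    using I that by (auto simp: is_ideal_def)
  have "equiv (carrier S) (rees_congruence S I)"
    using sub by (auto intro!: equivI refl_onI symI transI simp: rees_congruence_mem)
  moreover have "(x \<odot>\<^bsub>S\<^esub> y, x' \<odot>\<^bsub>S\<^esub> y') \<in> rees_congruence S I"
    if "(x, x') \<in> rees_congruence S I" "(y, y') \<in> rees_congruence S I" for x x' y y'
    using that ideal sub m_closed by (auto simp: rees_congruence_mem)
  ultimately show ?thesis by (auto simp: congruence_def)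
qed

section \<open>Images of free semigroups on two letters\<close>

text \<open>The semigroup is the image of the free semigroup on two letters, the elements of \<open>bool\<close>, under
  \<open>v\<close>, with kernel \<open>\<kappa>\<close>.\<close>

definition presented_sg :: "'s semigrp \<Rightarrow> (bool list \<Rightarrow> bool list \<Rightarrow> bool) \<Rightarrow> (bool list \<Rightarrow> 's) \<Rightarrow> bool" where
  "presented_sg S \<kappa> v \<longleftrightarrow> carrier S = v ` {w. w \<noteq> []} \<and>
     (\<forall>x y. x \<noteq> [] \<longrightarrow> y \<noteq> [] \<longrightarrow> v x \<odot>\<^bsub>S\<^esub> v y = v (x @ y) \<and> (v x = v y \<longleftrightarrow> \<kappa> x y))"

text \<open>The same for monoids, with the empty word naming the identity. Once a monoid is presented in this
  way, its elements are handled through words only and the iterated quotients stay closed.\<close>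

definition presented :: "'s semigrp \<Rightarrow> (bool list \<Rightarrow> bool list \<Rightarrow> bool) \<Rightarrow> (bool list \<Rightarrow> 's) \<Rightarrow> bool" where
  "presented S \<kappa> v \<longleftrightarrow> carrier S = range v \<and>
     (\<forall>x y. v x \<odot>\<^bsub>S\<^esub> v y = v (x @ y) \<and> (v x = v y \<longleftrightarrow> \<kappa> x y))"

lemma presentedD:
  assumes "presented S \<kappa> v"
  shows "carrier S = range v" "v x \<odot>\<^bsub>S\<^esub> v y = v (x @ y)" "v x = v y \<longleftrightarrow> \<kappa> x y"
  using assms by (auto simp: presented_def)

lemma presented_sgD:
  assumes "presented_sg S \<kappa> v"
  shows "carrier S = v ` {w. w \<noteq> []}"
    and "x \<noteq> [] \<Longrightarrow> y \<noteq> [] \<Longrightarrow> v x \<odot>\<^bsub>S\<^esub> v y = v (x @ y)"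
    and "x \<noteq> [] \<Longrightarrow> y \<noteq> [] \<Longrightarrow> v x = v y \<longleftrightarrow> \<kappa> x y"
  using assms unfolding presented_sg_def by blast+

lemma is_semigroup_presented_sg:
  assumes "presented_sg S \<kappa> v"
  shows "is_semigroup S"
proof
  show "carrier S \<noteq> {}" by (auto simp: presented_sgD(1)[OF assms])
next
  fix x y assume "x \<in> carrier S" "y \<in> carrier S"
  then show "x \<odot>\<^bsub>S\<^esub> y \<in> carrier S" by (auto simp: presented_sgD(1,2)[OF assms])
next
  fix x y z assume "x \<in> carrier S" "y \<in> carrier S" "z \<in> carrier S"
  then show "x \<odot>\<^bsub>S\<^esub> y \<odot>\<^bsub>S\<^esub> z = x \<odot>\<^bsub>S\<^esub> (y \<odot>\<^bsub>S\<^esub> z)"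
    by (auto simp: presented_sgD(1,2)[OF assms])
qed

lemma is_semigroup_presented:
  assumes "presented S \<kappa> v"
  shows "is_semigroup S"
proof
  show "carrier S \<noteq> {}" by (auto simp: presentedD(1)[OF assms])
next
  fix x y assume "x \<in> carrier S" "y \<in> carrier S"
  then show "x \<odot>\<^bsub>S\<^esub> y \<in> carrier S" by (auto simp: presentedD(1,2)[OF assms])
next
  fix x y z assume "x \<in> carrier S" "y \<in> carrier S" "z \<in> carrier S"
  then show "x \<odot>\<^bsub>S\<^esub> y \<odot>\<^bsub>S\<^esub> z = x \<odot>\<^bsub>S\<^esub> (y \<odot>\<^bsub>S\<^esub> z)"
    by (auto simp: presentedD(1,2)[OF assms])
qed

lemma presented_sg_quotient:
  assumes S: "presented_sg S \<kappa> v" and r: "congruence S r"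
    and \<kappa>': "\<And>x y. x \<noteq> [] \<Longrightarrow> y \<noteq> [] \<Longrightarrow> (v x, v y) \<in> r \<longleftrightarrow> \<kappa>' x y"
  shows "presented_sg (quotient_semigroup S r) \<kappa>' (\<lambda>w. r `` {v w})"
proof -
  note [simp] = presented_sgD[OF S]
  have "equiv (carrier S) r" using r by (simp add: congruence_def)
  then have "r `` {v x} = r `` {v y} \<longleftrightarrow> \<kappa>' x y" if "x \<noteq> []" "y \<noteq> []" for x y
    using that \<kappa>'[OF that] by (subst eq_equiv_class_iff) auto
  moreover have "r `` {v x} \<odot>\<^bsub>quotient_semigroup S r\<^esub> r `` {v y} = r `` {v (x @ y)}"
    if "x \<noteq> []" "y \<noteq> []" for x y
    using quotient_mult[OF r, of "v x" "v y"] that by auto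
  moreover have "carrier (quotient_semigroup S r) = (\<lambda>w. r `` {v w}) ` {w. w \<noteq> []}"
    by (auto simp: quotient_semigroup_def quotient_def)
  ultimately show ?thesis unfolding presented_sg_def by blast
qed

lemma presented_adjoin_one:
  assumes S: "presented_sg S \<kappa> v"
    and \<kappa>: "\<And>x. \<kappa> x [] \<longleftrightarrow> x = []" "\<And>y. \<kappa> [] y \<longleftrightarrow> y = []"
  shows "presented (adjoin_one S) \<kappa> (\<lambda>w. if w = [] then None else Some (v w))"
  unfolding presented_def
proof (intro conjI allI)
  show "carrier (adjoin_one S) = range (\<lambda>w. if w = [] then None else Some (v w))"
    by (auto simp: adjoin_one_def presented_sgD[OF S] image_iff)
qed (auto simp: adjoin_one_def presented_sgD[OF S] \<kappa>)

lemma word_product_Cons: "t \<noteq> [] \<Longrightarrow> word_product S (x # t) = x \<odot>\<^bsub>S\<^esub> word_product S t"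
  by (cases t) auto

lemma word_product_presented:
  assumes "presented S \<kappa> v" "t \<noteq> []"
  shows "word_product S (map (\<lambda>i. v (y i)) t) = v (concat (map y t))"
  using assms(2)
  by (induction t rule: list_nonempty_induct) (auto simp: word_product_Cons presentedD[OF assms(1)])

text \<open>The kernel of the map from the free monoid onto the free \<open>d\<close>-nilpotent monoid.\<close>

definition nil_eq :: "nat \<Rightarrow> 'b list \<Rightarrow> 'b list \<Rightarrow> bool" where
  "nil_eq d x y \<longleftrightarrow> x = y \<or> d \<le> length x \<and> d \<le> length y"

lemma presented_iso:
  assumes h: "h \<in> semigroup_iso T M" and sg: "is_semigroup T" and M: "presented M \<kappa> v"
  shows "presented T \<kappa> (\<lambda>w. inv_into (carrier T) h (v w))"
proof -
  let ?g = "inv_into (carrier T) h"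
  have bij: "bij_betw h (carrier T) (carrier M)"
    and hom: "\<And>x y. x \<in> carrier T \<Longrightarrow> y \<in> carrier T \<Longrightarrow> h (x \<odot>\<^bsub>T\<^esub> y) = h x \<odot>\<^bsub>M\<^esub> h y"
    using h by (auto simp: semigroup_iso_def)
  have g: "bij_betw ?g (carrier M) (carrier T)" by (rule bij_betw_inv_into[OF bij])
  have vM: "v w \<in> carrier M" for w by (simp add: presentedD(1)[OF M])
  have gT: "?g (v w) \<in> carrier T" for w using bij_betwE[OF g] vM by blast
  have hg: "h (?g (v w)) = v w" for w by (rule bij_betw_inv_into_right[OF bij vM])
  have "?g (v x) \<odot>\<^bsub>T\<^esub> ?g (v y) = ?g (v (x @ y))" for x y
  proof (rule inj_onD[OF bij_betw_imp_inj_on[OF bij]])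
    show "?g (v x) \<odot>\<^bsub>T\<^esub> ?g (v y) \<in> carrier T" by (rule is_semigroup.m_closed[OF sg gT gT])
    show "h (?g (v x) \<odot>\<^bsub>T\<^esub> ?g (v y)) = h (?g (v (x @ y)))"
      by (simp add: hom[OF gT gT] hg presentedD(2)[OF M])
  qed (rule gT)
  moreover have "carrier T = range (\<lambda>w. ?g (v w))"
    using bij_betw_imp_surj_on[OF g] by (simp add: presentedD(1)[OF M] image_image)
  moreover have "?g (v x) = ?g (v y) \<longleftrightarrow> \<kappa> x y" for x y
    using hg[of x] hg[of y] presentedD(3)[OF M] by metis
  ultimately show ?thesis unfolding presented_def by blast
qed

text \<open>All words of length at least \<open>d\<close> have the same value.\<close>

lemma finite_presented:
  assumes S: "presented S \<kappa> v" and le: "\<And>x y. nil_eq d x y \<Longrightarrow> \<kappa> x y"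
  shows "finite (carrier S)"
proof -
  have "v w \<in> v ` {w. length w \<le> d}" for w
  proof (cases "length w \<le> d")
    case False
    then have "v w = v (replicate d True)"
      unfolding presentedD(3)[OF S] by (intro le) (simp add: nil_eq_def)
    then show ?thesis by (intro image_eqI[of _ _ "replicate d True"]) simp_all
  qed simp
  then have "carrier S \<subseteq> v ` {w. length w \<le> d}" by (auto simp: presentedD(1)[OF S])
  moreover have "finite {w :: bool list. length w \<le> d}"
    using finite_lists_length_le[of "UNIV :: bool set" d] by simp
  ultimately show ?thesis using finite_surj by blast
qed

section \<open>Identities of free nilpotent monoids\<close>

text \<open>This is the equational theory of the free \<open>d\<close>-nilpotent monoid on at least two letters, by
  \<open>nil_eq_evaluation\<close> and \<open>short_eq_of_evaluations\<close>. Deleting letters amounts to substituting the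
  identity for variables.\<close>

definition short_eq :: "nat \<Rightarrow> 'b list \<Rightarrow> 'b list \<Rightarrow> bool" where
  "short_eq d u v \<longleftrightarrow>
     (\<forall>P. length (filter P u) < d \<or> length (filter P v) < d \<longrightarrow> filter P u = filter P v)"

lemma short_eqD:
  "short_eq d u v \<Longrightarrow> length (filter P u) < d \<or> length (filter P v) < d \<Longrightarrow> filter P u = filter P v"
  by (auto simp: short_eq_def)

lemma short_eq_min_length:
  assumes "short_eq d u v"
  shows "min d (length (filter P u)) = min d (length (filter P v))"
proof (cases "length (filter P u) < d \<or> length (filter P v) < d")
  case True
  then show ?thesis using short_eqD[OF assms] by metis
qed auto

lemma concat_map_filter:
  "(\<And>i. i \<in> set t \<Longrightarrow> \<not> P i \<Longrightarrow> y i = []) \<Longrightarrow> concat (map y t) = concat (map y (filter P t))"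
  by (induction t) auto

lemma length_le_concat_map: "(\<And>i. i \<in> set t \<Longrightarrow> y i \<noteq> []) \<Longrightarrow> length t \<le> length (concat (map y t))"
proof (induction t)
  case (Cons i t)
  then have "y i \<noteq> []" "length t \<le> length (concat (map y t))" by auto
  then show ?case by (cases "y i") auto
qed simp

text \<open>Variables with empty value can be deleted from both words. If fewer than \<open>d\<close> occurrences remain on
  one side, the words become equal; otherwise every remaining occurrence contributes at least one
  letter, and both values have length at least \<open>d\<close>.\<close>

lemma nil_eq_evaluation:
  assumes "short_eq d u w"
  shows "nil_eq d (concat (map y u)) (concat (map y w))"
proof -
  let ?P = "\<lambda>i. y i \<noteq> []"
  have eq: "concat (map y t) = concat (map y (filter ?P t))" for t by (rule concat_map_filter) auto
  have le: "length (filter ?P t) \<le> length (concat (map y t))" for t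
    unfolding eq[of t] by (rule length_le_concat_map) auto
  show ?thesis
  proof (cases "length (filter ?P u) < d \<or> length (filter ?P w) < d")
    case True
    then have "filter ?P u = filter ?P w" by (rule short_eqD[OF assms])
    then show ?thesis using eq[of u] eq[of w] by (simp add: nil_eq_def)
  next
    case False
    then show ?thesis using le[of u] le[of w] by (auto simp: nil_eq_def)
  qed
qed

text \<open>Two letters are enough to separate words: substitute one of them for a single variable \<open>c\<close> and the
  other one for all remaining variables that satisfy \<open>P\<close>. The value then shows the positions
  of \<open>c\<close>, provided that it is shorter than \<open>d\<close>.\<close>

lemma short_eq_of_evaluations:
  assumes "\<And>y :: 'b \<Rightarrow> bool list. nil_eq d (concat (map y u)) (concat (map y w))"
  shows "short_eq d u w"
  unfolding short_eq_def
proof (intro allI impI)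
  fix P assume short: "length (filter P u) < d \<or> length (filter P w) < d"
  have ev: "concat (map (\<lambda>i. if P i then [g i] else []) t) = map g (filter P t)" for g :: "'b \<Rightarrow> bool" and t :: "'b list"
    by (induction t) auto
  have nil: "nil_eq d (map g (filter P u)) (map g (filter P w))" for g :: "'b \<Rightarrow> bool"
    using assms[of "\<lambda>i. if P i then [g i] else []"] by (simp only: ev)
  have eq: "map g (filter P u) = map g (filter P w)" for g :: "'b \<Rightarrow> bool"
    using nil[of g] short unfolding nil_eq_def length_map by linarith
  show "filter P u = filter P w"
  proof (rule nth_equalityI)
    show len: "length (filter P u) = length (filter P w)"
      using arg_cong[OF eq[of "\<lambda>_. True"], of length] by simp
    fix k assume k: "k < length (filter P u)"
    define c where "c = filter P u ! k"
    have "map (\<lambda>i. i = c) (filter P u) ! k = map (\<lambda>i. i = c) (filter P w) ! k"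
      by (simp only: eq)
    then show "filter P u ! k = filter P w ! k" using k len by (simp add: c_def)
  qed
qed

lemma short_eq_word_product:
  assumes P: "presented S \<kappa> v" and le: "\<And>x y. nil_eq d x y \<Longrightarrow> \<kappa> x y"
    and uw: "short_eq d u w" "u \<noteq> []" "w \<noteq> []" and y: "\<And>i. y i \<in> carrier S"
  shows "word_product S (map y u) = word_product S (map y w)"
proof -
  have "\<forall>i. \<exists>x. y i = v x" using y by (auto simp: presentedD(1)[OF P])
  then obtain g where g: "y = (\<lambda>i. v (g i))" by metis
  show ?thesis
    unfolding g word_product_presented[OF P uw(2)] word_product_presented[OF P uw(3)] presentedD(3)[OF P]
    by (rule le[OF nil_eq_evaluation[OF uw(1)]])
qed

section \<open>The kernels of the two monoids\<close>

abbreviation (input) letter :: "'a \<Rightarrow> 'a \<Rightarrow> bool \<Rightarrow> 'a" where "letter a b c \<equiv> if c then a else b"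

lemma presented_free_semigroup:
  assumes "a \<noteq> b"
  shows "presented_sg (free_semigroup {a, b}) (=) (map (letter a b))"
proof -
  have inj: "inj (letter a b)" using assms by (auto simp: inj_def)
  have "w \<in> map (letter a b) ` {w. w \<noteq> []}" if "w \<noteq> []" "set w \<subseteq> {a, b}" for w
  proof
    show "w = map (letter a b) (map (\<lambda>x. x = a) w)" using that by (auto intro!: map_idI[symmetric])
    show "map (\<lambda>x. x = a) w \<in> {w. w \<noteq> []}" using that by simp
  qed
  then have "carrier (free_semigroup {a, b}) = map (letter a b) ` {w. w \<noteq> []}"
    by (auto simp: free_semigroup_def)
  then show ?thesis
    using inj by (auto simp: presented_sg_def free_semigroup_def inj_map_eq_map)
qed

lemma is_ideal_long_words:
  assumes "A \<noteq> {}"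
  shows "is_ideal (long_words d A) (free_semigroup A)"
proof -
  obtain x where "x \<in> A" using assms by auto
  then have "replicate (Suc d) x \<in> long_words d A"
    by (auto simp: long_words_def free_semigroup_def)
  then have "long_words d A \<noteq> {}" by blast
  then show ?thesis
    by (auto simp: is_ideal_def subsemigroup_def long_words_def free_semigroup_def)
qed

lemma presented_free_nilpotent:
  assumes "a \<noteq> b"
  shows "presented_sg (free_nilpotent d {a, b}) (nil_eq d) (\<lambda>w. nil_class d {a, b} (map (letter a b) w))"
  unfolding free_nilpotent_def rees_quotient_def nil_class_def
proof (rule presented_sg_quotient[OF presented_free_semigroup[OF assms]])
  show "congruence (free_semigroup {a, b}) (rees_congruence (free_semigroup {a, b}) (long_words d {a, b}))"
    by (rule congruence_rees[OF is_semigroup_presented_sg[OF presented_free_semigroup[OF assms]]])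
      (simp add: is_ideal_long_words)
  have inj: "inj (letter a b)" using assms by (auto simp: inj_def)
  show "((map (letter a b) x, map (letter a b) y) \<in> rees_congruence (free_semigroup {a, b}) (long_words d {a, b}))
        = nil_eq d x y" if "x \<noteq> []" "y \<noteq> []" for x y
    using that inj
    by (auto simp: rees_congruence_mem long_words_def free_semigroup_def nil_eq_def inj_map_eq_map)
qed

text \<open>The kernel of \<open>S\<close>. Negating every letter exchanges the two generators, and this takes \<open>(ab)\<^sup>2\<close>
  to \<open>(ba)\<^sup>2\<close> and \<open>a\<^sup>2b\<^sup>2\<close> to \<open>b\<^sup>2a\<^sup>2\<close>.\<close>

definition theta_eq :: "bool list \<Rightarrow> bool list \<Rightarrow> bool" where
  "theta_eq x y \<longleftrightarrow> nil_eq 5 x y \<or>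
     x \<in> {[True, False, True, False], [False, True, False, True],
          [True, True, False, False], [False, False, True, True]} \<and> y = map Not x"

text \<open>Words that \<open>\<theta>\<close> identifies without being equal have length 4, so their products with nonempty
  words are zero. This makes \<open>\<theta>\<close> compatible with multiplication.\<close>

lemma presented_theta_quotient:
  assumes "a \<noteq> b"
  shows "presented_sg (quotient_semigroup (free_nilpotent 5 {a, b}) (theta a b)) theta_eq
           (\<lambda>w. theta a b `` {nil_class 5 {a, b} (map (letter a b) w)})"
proof -
  let ?N = "free_nilpotent 5 {a, b}"
  define q where "q w = nil_class 5 {a, b} (map (letter a b) w)" for w
  have N: "presented_sg ?N (nil_eq 5) q"
    unfolding q_def by (rule presented_free_nilpotent[OF assms])
  note D = presented_sgD[OF N]
  let ?ab = "[True, False, True, False]" let ?ba = "[False, True, False, True]"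
  let ?aa = "[True, True, False, False]" let ?bb = "[False, False, True, True]"
  have pairs: "theta_pairs a b = {{q ?ab, q ?ba}, {q ?aa, q ?bb}}"
    by (simp add: theta_pairs_def q_def)
  have dist: "q ?ab \<noteq> q ?aa" "q ?ab \<noteq> q ?bb" "q ?ba \<noteq> q ?aa" "q ?ba \<noteq> q ?bb"
    by (simp_all add: D nil_eq_def)
  have car: "q ?ab \<in> carrier ?N" "q ?ba \<in> carrier ?N" "q ?aa \<in> carrier ?N" "q ?bb \<in> carrier ?N"
    by (auto simp: D)
  define A B where AB: "A = {q ?ab, q ?ba}" "B = {q ?aa, q ?bb}"
  have sub: "A \<subseteq> carrier ?N" "B \<subseteq> carrier ?N" "A \<inter> B = {}" using car dist by (auto simp: AB)
  have mem: "(X, Y) \<in> theta a b \<longleftrightarrow> X = Y \<and> X \<in> carrier ?N \<or> X \<in> A \<and> Y \<in> A \<or> X \<in> B \<and> Y \<in> B" for X Y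
  proof -
    have *: "(X, Y) \<in> (\<Union>C\<in>{A, B} \<union> {{x} |x. x \<in> M - \<Union> {A, B}}. C \<times> C) \<longleftrightarrow>
        X = Y \<and> X \<in> M \<or> X \<in> A \<and> Y \<in> A \<or> X \<in> B \<and> Y \<in> B"
      if "A \<subseteq> M" "B \<subseteq> M" for A B M
      using that by auto
    show ?thesis
      unfolding theta_def theta_classes_def pairs AB[symmetric] by (rule *) (rule sub)+
  qed
  have equiv: "equiv (carrier ?N) (theta a b)"
  proof (intro equivI refl_onI symI transI)
    have "X \<in> carrier ?N \<and> Y \<in> carrier ?N" if "(X, Y) \<in> theta a b" for X Y
      using that sub(1,2) unfolding mem by blast
    then show "theta a b \<subseteq> carrier ?N \<times> carrier ?N" by auto
    show "(Y, X) \<in> theta a b" if "(X, Y) \<in> theta a b" for X Y using that unfolding mem by blast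
    show "(X, Z) \<in> theta a b" if "(X, Y) \<in> theta a b" "(Y, Z) \<in> theta a b" for X Y Z
      using that sub(3) unfolding mem by blast
  qed (simp add: mem)
  have iff: "(q x, q y) \<in> theta a b \<longleftrightarrow> theta_eq x y" if "x \<noteq> []" "y \<noteq> []" for x y
  proof -
    have *: "q w = q w' \<longleftrightarrow> w = w'" if "length w' = 4" "w \<noteq> []" for w w'
    proof -
      have "w' \<noteq> []" using that(1) by auto
      then show ?thesis using D(3)[OF that(2)] that(1) by (auto simp: nil_eq_def)
    qed
    have inAB: "q x \<in> A \<longleftrightarrow> x \<in> {?ab, ?ba}" "q x \<in> B \<longleftrightarrow> x \<in> {?aa, ?bb}" if "x \<noteq> []" for x
      using that by (simp_all add: AB *)
    have "q x \<in> carrier ?N" using that(1) by (auto simp: D(1))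
    then have "(q x, q y) \<in> theta a b \<longleftrightarrow> nil_eq 5 x y \<or> x \<in> {?ab, ?ba} \<and> y \<in> {?ab, ?ba} \<or>
        x \<in> {?aa, ?bb} \<and> y \<in> {?aa, ?bb}"
      using that by (simp only: mem inAB D(3) simp_thms)
    also have "\<dots> \<longleftrightarrow> theta_eq x y"
      unfolding theta_eq_def by (auto simp: nil_eq_def)
    finally show ?thesis .
  qed
  have zero: "q (x @ w) = q (y @ w')" "q (w @ x) = q (w' @ y)"
    if "length x = 4" "length y = 4" "w \<noteq> []" "w' \<noteq> []" for x y w w'
  proof -
    have "length w \<noteq> 0" "length w' \<noteq> 0" using that by simp_all
    then have "nil_eq 5 (x @ w) (y @ w')" "nil_eq 5 (w @ x) (w' @ y)"
      using that(1,2) unfolding nil_eq_def by (simp_all add: Suc_le_eq)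
    then show "q (x @ w) = q (y @ w')" "q (w @ x) = q (w' @ y)"
      using that(3,4) by (simp_all add: D(3))
  qed
  have rep: "\<exists>x y. x \<noteq> [] \<and> y \<noteq> [] \<and> X = q x \<and> Y = q y \<and> (x = y \<or> length x = 4 \<and> length y = 4)"
    if XY: "(X, Y) \<in> theta a b" for X Y
  proof -
    consider "X = Y" "X \<in> carrier ?N" | "X \<in> A \<union> B" "Y \<in> A \<union> B"
      using XY unfolding mem by blast
    then show ?thesis
    proof cases
      case 1
      then show ?thesis by (auto simp: D)
    next
      case 2
      have len4: "\<exists>x. x \<noteq> [] \<and> Z = q x \<and> length x = 4" if Z: "Z \<in> A \<union> B" for Z
      proof -
        obtain x where "x \<in> {?ab, ?ba, ?aa, ?bb}" "Z = q x" using Z by (auto simp: AB)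
        then show ?thesis by (intro exI[of _ x]) auto
      qed
      obtain x y where "x \<noteq> [] \<and> X = q x \<and> length x = 4" "y \<noteq> [] \<and> Y = q y \<and> length y = 4"
        using len4[OF 2(1)] len4[OF 2(2)] by auto
      then show ?thesis by (intro exI[of _ x] exI[of _ y]) simp
    qed
  qed
  have "(X \<odot>\<^bsub>?N\<^esub> Y, X' \<odot>\<^bsub>?N\<^esub> Y') \<in> theta a b" if XX: "(X, X') \<in> theta a b" and YY: "(Y, Y') \<in> theta a b" for X X' Y Y'
  proof -
    obtain x x' where x: "x \<noteq> []" "x' \<noteq> []" "X = q x" "X' = q x'" "x = x' \<or> length x = 4 \<and> length x' = 4"
      using rep[OF XX] by blast
    obtain y y' where y: "y \<noteq> []" "y' \<noteq> []" "Y = q y" "Y' = q y'" "y = y' \<or> length y = 4 \<and> length y' = 4"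
      using rep[OF YY] by blast
    have "q (x @ y) = q (x' @ y')"
      using x y zero(1)[of x x' y y'] zero(2)[of y y' x x'] by auto
    moreover have "q (x @ y) \<in> carrier ?N" using x by (auto simp: D)
    ultimately show ?thesis using x y by (simp add: D mem)
  qed
  then have "congruence ?N (theta a b)" using equiv by (simp add: congruence_def)
  from presented_sg_quotient[OF N this, of theta_eq] iff show ?thesis by (simp add: q_def)
qed

section \<open>Finite relatedness and identification of variables\<close>

lemma nth_mem_carrier: "x \<in> tuples n A \<Longrightarrow> i < n \<Longrightarrow> x ! i \<in> A"
  by (auto simp: tuples_def)

lemma map_upt_tuples: "(\<And>i. i < n \<Longrightarrow> y i \<in> A) \<Longrightarrow> map y [0..<n] \<in> tuples n A"
  by (auto simp: tuples_def)

lemma finite_tuples: "finite A \<Longrightarrow> finite (tuples n A)"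
  using finite_lists_length_eq[of A n] by (simp add: tuples_def conj_commute)

lemma term_function_apply:
  "x \<in> tuples n (carrier S) \<Longrightarrow> term_function S n t x = word_product S (map (\<lambda>i. x ! i) t)"
  by (simp add: term_function_def)

context is_semigroup
begin

lemma word_product_closed: "xs \<noteq> [] \<Longrightarrow> set xs \<subseteq> carrier S \<Longrightarrow> word_product S xs \<in> carrier S"
  by (induction xs rule: list_nonempty_induct) (auto simp: word_product_Cons m_closed)

lemma word_product_append:
  assumes "xs \<noteq> []" "ys \<noteq> []" "set xs \<subseteq> carrier S" "set ys \<subseteq> carrier S"
  shows "word_product S (xs @ ys) = word_product S xs \<odot> word_product S ys"
  using assms
  by (induction xs rule: list_nonempty_induct)
    (auto simp: word_product_Cons m_assoc word_product_closed)

lemma word_product_concat: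
  assumes "t \<noteq> []" "\<And>i. i \<in> set t \<Longrightarrow> \<sigma> i \<noteq> [] \<and> set (\<sigma> i) \<subseteq> carrier S"
  shows "word_product S (map (\<lambda>i. word_product S (\<sigma> i)) t) = word_product S (concat (map \<sigma> t))"
  using assms
proof (induction t rule: list_nonempty_induct)
  case (cons i t)
  have "concat (map \<sigma> t) \<noteq> []" using cons.hyps cons.prems by (cases t) auto
  moreover have "set (concat (map \<sigma> t)) \<subseteq> carrier S" using cons.prems by auto
  ultimately show ?case
    using cons by (simp add: word_product_Cons word_product_append)
qed simp

end

text \<open>Identifying the \<open>n\<close> variables of \<open>f\<close> along \<open>\<phi>\<close> yields an operation in the variables
  \<open>\<phi> ` {..<n}\<close>, here required to be the term function of \<open>w\<close>. The new variables may be arbitrary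
  numbers, so that a map can keep the names of some variables while it merges the others.\<close>

definition minor_word :: "'s semigrp \<Rightarrow> nat \<Rightarrow> ('s list \<Rightarrow> 's) \<Rightarrow> (nat \<Rightarrow> nat) \<Rightarrow> nat list \<Rightarrow> bool" where
  "minor_word S n f \<phi> w \<longleftrightarrow> w \<noteq> [] \<and> set w \<subseteq> \<phi> ` {..<n} \<and>
     (\<forall>y. (\<forall>i. y i \<in> carrier S) \<longrightarrow> f (map (\<lambda>i. y (\<phi> i)) [0..<n]) = word_product S (map y w))"

text \<open>A single relation does it: the \<open>m\<close>-ary term functions, each written as the tuple of its values. An
  operation preserving it maps \<open>m\<close>-ary term functions to \<open>m\<close>-ary term functions, in particular when
  these are projections, which gives a word for each minor in at most \<open>m\<close> variables.\<close>

lemma finitely_relatedI: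
  fixes S :: "'s semigrp"
  assumes sg: "is_semigroup S" and fin: "finite (carrier S)" and m: "1 \<le> m"
    and step: "\<And>n f. 1 \<le> n \<Longrightarrow> f \<in> tuples n (carrier S) \<rightarrow>\<^sub>E carrier S \<Longrightarrow>
       (\<And>\<phi>. card (\<phi> ` {..<n}) \<le> m \<Longrightarrow> \<exists>w. minor_word S n f \<phi> w) \<Longrightarrow> \<exists>t. minor_word S n f id t"
  shows "finitely_related S"
proof -
  interpret is_semigroup S by (rule sg)
  let ?C = "carrier S"
  obtain args where args: "set args = tuples m ?C"
    using finite_list[OF finite_tuples[OF fin]] by blast
  define k where "k = length args"
  define \<Gamma> where "\<Gamma> = (\<lambda>s. map (term_function S m s) args) ` {s. s \<noteq> [] \<and> set s \<subseteq> {..<m}}"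
  have arg: "args ! j \<in> tuples m ?C" if "j < k" for j using nth_mem[of j args] that unfolding args k_def by blast
  obtain c where c: "c \<in> ?C" using nonempty by auto
  have "replicate m c \<in> set args" unfolding args using c by (auto simp: tuples_def)
  then have k: "1 \<le> k" by (cases args) (simp_all add: k_def)
  have term_closed: "term_function S n t x \<in> ?C"
    if "t \<noteq> []" "set t \<subseteq> {..<n}" "x \<in> tuples n ?C" for n t x
  proof -
    have "x ! i \<in> ?C" if "i \<in> set t" for i
      using nth_mem_carrier[OF \<open>x \<in> tuples n ?C\<close>, of i] that \<open>set t \<subseteq> {..<n}\<close> by blast
    then show ?thesis
      using \<open>t \<noteq> []\<close> by (auto simp: term_function_apply[OF \<open>x \<in> tuples n ?C\<close>] intro!: word_product_closed)
  qed
  have \<Gamma>_sub: "\<Gamma> \<subseteq> tuples k ?C"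
  proof
    fix r assume "r \<in> \<Gamma>"
    then obtain s where s: "s \<noteq> []" "set s \<subseteq> {..<m}" "r = map (term_function S m s) args"
      by (auto simp: \<Gamma>_def)
    have "set r \<subseteq> ?C" unfolding s(3) set_map args using term_closed[OF s(1,2)] by blast
    then show "r \<in> tuples k ?C" by (simp add: tuples_def k_def s(3))
  qed
  have terms_preserve: "preserves n k (term_function S n t) \<Gamma>" if t: "t \<noteq> []" "set t \<subseteq> {..<n}" for n t
    unfolding preserves_def
  proof
    fix rs assume rs: "rs \<in> tuples n \<Gamma>"
    define \<sigma> where "\<sigma> i = (SOME s. s \<noteq> [] \<and> set s \<subseteq> {..<m} \<and> rs ! i = map (term_function S m s) args)" for i
    have \<sigma>: "\<sigma> i \<noteq> [] \<and> set (\<sigma> i) \<subseteq> {..<m} \<and> rs ! i = map (term_function S m (\<sigma> i)) args" if "i < n" for i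
      unfolding \<sigma>_def
      by (rule someI_ex) (use nth_mem_carrier[OF rs that] in \<open>auto simp: \<Gamma>_def\<close>)
    let ?s = "concat (map \<sigma> t)"
    have \<sigma>t: "\<sigma> i \<noteq> []" "set (\<sigma> i) \<subseteq> {..<m}" if "i \<in> set t" for i
      using \<sigma>[of i] t that by auto
    have s: "?s \<noteq> []" "set ?s \<subseteq> {..<m}"
      using t(1) \<sigma>t[of "hd t"] \<sigma>t by (cases t; auto)+
    have "term_function S n t (map (\<lambda>r. r ! j) rs) = term_function S m ?s (args ! j)" if j: "j < k" for j
    proof -
      have col: "map (\<lambda>r. r ! j) rs \<in> tuples n ?C"
      proof -
        have "r ! j \<in> ?C" if "r \<in> set rs" for r
          using rs \<Gamma>_sub j nth_mem_carrier[of r k ?C j] that by (auto simp: tuples_def[of n])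
        then show ?thesis using rs by (auto simp: tuples_def)
      qed
      have "term_function S n t (map (\<lambda>r. r ! j) rs) = word_product S (map (\<lambda>i. map (\<lambda>r. r ! j) rs ! i) t)"
        by (rule term_function_apply[OF col])
      also have "map (\<lambda>i. map (\<lambda>r. r ! j) rs ! i) t =
          map (\<lambda>i. word_product S (map (\<lambda>l. args ! j ! l) (\<sigma> i))) t"
      proof (rule map_cong[OF refl])
        fix i assume "i \<in> set t"
        then have i: "i < n" using t by auto
        then have "map (\<lambda>r. r ! j) rs ! i = rs ! i ! j" using rs by (simp add: tuples_def)
        also have "\<dots> = term_function S m (\<sigma> i) (args ! j)" using \<sigma>[OF i] j by (simp add: k_def)
        finally show "map (\<lambda>r. r ! j) rs ! i = word_product S (map (\<lambda>l. args ! j ! l) (\<sigma> i))"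
          by (simp add: term_function_apply[OF arg[OF j]])
      qed
      also have "word_product S \<dots> = word_product S (concat (map (\<lambda>i. map (\<lambda>l. args ! j ! l) (\<sigma> i)) t))"
      proof (rule word_product_concat[OF t(1)])
        fix i assume "i \<in> set t"
        note \<sigma>t[OF this]
        then show "map (\<lambda>l. args ! j ! l) (\<sigma> i) \<noteq> [] \<and> set (map (\<lambda>l. args ! j ! l) (\<sigma> i)) \<subseteq> ?C"
          using nth_mem_carrier[OF arg[OF j]] by auto
      qed
      also have "concat (map (\<lambda>i. map (\<lambda>l. args ! j ! l) (\<sigma> i)) t) = map (\<lambda>l. args ! j ! l) ?s"
        by (simp add: map_concat comp_def)
      also have "word_product S \<dots> = term_function S m ?s (args ! j)"
        by (rule term_function_apply[OF arg[OF j], symmetric])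
      finally show ?thesis .
    qed
    then have "map (\<lambda>j. term_function S n t (map (\<lambda>r. r ! j) rs)) [0..<k] = map (term_function S m ?s) args"
      by (intro nth_equalityI) (auto simp: k_def)
    then show "map (\<lambda>j. term_function S n t (map (\<lambda>r. r ! j) rs)) [0..<k] \<in> \<Gamma>"
      unfolding \<Gamma>_def using s by blast
  qed
  have minors: "\<exists>w. minor_word S n f \<phi> w"
    if n: "1 \<le> n" and f: "preserves n k f \<Gamma>" and \<phi>: "card (\<phi> ` {..<n}) \<le> m" for n f \<phi>
  proof -
    obtain h where h: "h ` \<phi> ` {..<n} \<subseteq> {..<m}" "inj_on h (\<phi> ` {..<n})"
      using card_le_inj[of "\<phi> ` {..<n}" "{..<m}"] \<phi> unfolding card_lessThan by blast
    define rs where "rs = map (\<lambda>i. map (term_function S m [h (\<phi> i)]) args) [0..<n]"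
    have "map (term_function S m [h (\<phi> i)]) args \<in> \<Gamma>" if "i < n" for i
      unfolding \<Gamma>_def by (rule imageI) (use h(1) that in auto)
    then have "rs \<in> tuples n \<Gamma>" by (auto simp: rs_def tuples_def)
    then have "map (\<lambda>j. f (map (\<lambda>r. r ! j) rs)) [0..<k] \<in> \<Gamma>" using f by (auto simp: preserves_def)
    then obtain s where s: "s \<noteq> []" "set s \<subseteq> {..<m}"
      "map (\<lambda>j. f (map (\<lambda>r. r ! j) rs)) [0..<k] = map (term_function S m s) args"
      unfolding \<Gamma>_def by blast
    have fs: "f (map (\<lambda>i. x ! h (\<phi> i)) [0..<n]) = word_product S (map (\<lambda>l. x ! l) s)" if x: "x \<in> tuples m ?C" for x
    proof -
      obtain j where j: "j < k" "args ! j = x" using x unfolding args[symmetric] in_set_conv_nth k_def by blast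
      have "f (map (\<lambda>r. r ! j) rs) = term_function S m s (args ! j)"
        using arg_cong[OF s(3), of "\<lambda>l. l ! j"] j(1) by (simp add: k_def)
      moreover have "map (\<lambda>r. r ! j) rs = map (\<lambda>i. x ! h (\<phi> i)) [0..<n]"
        using j x by (auto simp: rs_def k_def term_function_apply)
      ultimately show ?thesis using j x by (simp add: term_function_apply)
    qed
    \<comment> \<open>The word may contain letters that name no variable of the minor; these can be
      replaced by any variable, as the identified operation does not depend on them.\<close>
    define g where "g l = (if l \<in> h ` \<phi> ` {..<n} then inv_into (\<phi> ` {..<n}) h l else \<phi> 0)" for l
    have g: "g l \<in> \<phi> ` {..<n}" for l
      using n inv_into_into[of l h "\<phi> ` {..<n}"] by (auto simp: g_def)
    have gh: "g (h (\<phi> i)) = \<phi> i" if "i < n" for i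
      using that h(2) by (auto simp: g_def)
    have "f (map (\<lambda>i. y (\<phi> i)) [0..<n]) = word_product S (map y (map g s))" if y: "\<forall>i. y i \<in> ?C" for y
    proof -
      let ?x = "map (\<lambda>l. y (g l)) [0..<m]"
      have x: "?x \<in> tuples m ?C" using y by (intro map_upt_tuples) auto
      have "map (\<lambda>i. y (\<phi> i)) [0..<n] = map (\<lambda>i. ?x ! h (\<phi> i)) [0..<n]"
        using h(1) gh by (auto simp: image_subset_iff)
      moreover have "map (\<lambda>l. ?x ! l) s = map y (map g s)" using s(2) by (auto simp: subset_iff)
      ultimately show ?thesis using fs[OF x] by (simp only:)
    qed
    moreover have "set (map g s) \<subseteq> \<phi> ` {..<n}" using g by auto
    ultimately have "minor_word S n f \<phi> (map g s)" using s(1) unfolding minor_word_def by blast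
    then show ?thesis by blast
  qed
  have "term_functions S n = {f \<in> tuples n ?C \<rightarrow>\<^sub>E ?C. preserves n k f \<Gamma>}" if n: "1 \<le> n" for n
  proof
    show "term_functions S n \<subseteq> {f \<in> tuples n ?C \<rightarrow>\<^sub>E ?C. preserves n k f \<Gamma>}"
    proof
      fix f assume "f \<in> term_functions S n"
      then obtain t where t: "t \<noteq> []" "set t \<subseteq> {..<n}" "f = term_function S n t"
        by (auto simp: term_functions_def)
      have "f \<in> tuples n ?C \<rightarrow>\<^sub>E ?C"
        unfolding t(3) by (rule PiE_I) (use term_closed[OF t(1,2)] in \<open>auto simp: term_function_def\<close>)
      then show "f \<in> {f \<in> tuples n ?C \<rightarrow>\<^sub>E ?C. preserves n k f \<Gamma>}"
        using terms_preserve[OF t(1,2)] t(3) by blast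
    qed
    show "{f \<in> tuples n ?C \<rightarrow>\<^sub>E ?C. preserves n k f \<Gamma>} \<subseteq> term_functions S n"
    proof clarify
      fix f assume f: "f \<in> tuples n ?C \<rightarrow>\<^sub>E ?C" "preserves n k f \<Gamma>"
      obtain t where t: "minor_word S n f id t"
        using step[OF n f(1)] minors[OF n f(2)] by blast
      then have t': "t \<noteq> []" "set t \<subseteq> {..<n}" by (auto simp: minor_word_def)
      have "f = term_function S n t"
      proof (rule PiE_ext[OF f(1)])
        show "term_function S n t \<in> tuples n ?C \<rightarrow>\<^sub>E ?C"
          by (rule PiE_I) (use term_closed[OF t'] in \<open>auto simp: term_function_def\<close>)
        fix x assume x: "x \<in> tuples n ?C"
        define y where "y i = (if i < n then x ! i else c)" for i
        have y: "\<forall>i. y i \<in> ?C" using nth_mem_carrier[OF x] c by (auto simp: y_def)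
        have "map (\<lambda>i. y (id i)) [0..<n] = x"
          using x by (intro nth_equalityI) (auto simp: y_def tuples_def)
        moreover have "map y t = map (\<lambda>i. x ! i) t" using t'(2) by (auto simp: y_def)
        moreover have "f (map (\<lambda>i. y (id i)) [0..<n]) = word_product S (map y t)"
          using t y unfolding minor_word_def by blast
        ultimately show "f x = term_function S n t x"
          by (simp only: term_function_apply[OF x])
      qed
      then show "f \<in> term_functions S n" using t' by (auto simp: term_functions_def)
    qed
  qed
  then show ?thesis
    unfolding finitely_related_def using k \<Gamma>_sub by (intro exI[of _ "{(k, \<Gamma>)}"]) auto
qed

text \<open>Pigeonhole: if \<open>f\<close> has more arguments than a relation has elements, then two of the arguments taken
  from the relation coincide, and on such arguments \<open>f\<close> agrees with a term function, which preserves
  the relation. So beyond a certain arity the condition on identified variables already puts \<open>f\<close>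
  into the clone.\<close>

lemma finitely_related_arity_bound:
  assumes fr: "finitely_related S" and fin: "finite (carrier S)"
  shows "\<exists>N. \<forall>n\<ge>N. \<forall>f \<in> tuples n (carrier S) \<rightarrow>\<^sub>E carrier S.
    (\<forall>i<n. \<forall>j<n. i \<noteq> j \<longrightarrow> (\<exists>t. t \<noteq> [] \<and> set t \<subseteq> {..<n} \<and>
        (\<forall>x\<in>tuples n (carrier S). x ! i = x ! j \<longrightarrow> f x = term_function S n t x))) \<longrightarrow>
    f \<in> term_functions S n"
proof -
  let ?C = "carrier S"
  obtain \<R> :: "(nat \<times> 'a list set) set" where \<R>: "finite \<R>"
    "\<forall>(k, R)\<in>\<R>. 1 \<le> k \<and> R \<subseteq> tuples k ?C"
    "\<forall>n\<ge>1. term_functions S n = {f \<in> tuples n ?C \<rightarrow>\<^sub>E ?C. \<forall>(k, R)\<in>\<R>. preserves n k f R}"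
    using fr unfolding finitely_related_def by blast
  have sub: "R \<subseteq> tuples k ?C" if "(k, R) \<in> \<R>" for k R using \<R>(2) that by blast
  have clone: "term_functions S n = {f \<in> tuples n ?C \<rightarrow>\<^sub>E ?C. \<forall>(k, R)\<in>\<R>. preserves n k f R}"
    if "1 \<le> n" for n using \<R>(3) that by blast
  define N where "N = Suc (\<Sum>p\<in>\<R>. card (snd p))"
  have bound: "f \<in> term_functions S n"
    if n: "N \<le> n" and f: "f \<in> tuples n ?C \<rightarrow>\<^sub>E ?C"
      and minors: "\<And>i j. i < n \<Longrightarrow> j < n \<Longrightarrow> i \<noteq> j \<Longrightarrow> \<exists>t. t \<noteq> [] \<and> set t \<subseteq> {..<n} \<and>
        (\<forall>x\<in>tuples n ?C. x ! i = x ! j \<longrightarrow> f x = term_function S n t x)" for n f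
  proof -
    have n1: "1 \<le> n" using n by (simp add: N_def)
    have "preserves n k f R" if R: "(k, R) \<in> \<R>" for k R
      unfolding preserves_def
    proof
      fix rs assume rs: "rs \<in> tuples n R"
      have finR: "finite R" using sub[OF R] finite_tuples[OF fin] finite_subset by blast
      have "card R \<le> (\<Sum>p\<in>\<R>. card (snd p))"
        using member_le_sum[of "(k, R)" \<R> "\<lambda>p. card (snd p)"] R \<R>(1) by simp
      then have "card (set rs) < length rs"
        using card_mono[OF finR, of "set rs"] rs n by (simp add: tuples_def N_def)
      then have "\<not> distinct rs" using distinct_card by fastforce
      then obtain i j where ij: "i < n" "j < n" "i \<noteq> j" "rs ! i = rs ! j"
        using rs by (auto simp: distinct_conv_nth tuples_def)
      obtain t where t: "t \<noteq> []" "set t \<subseteq> {..<n}"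
        "\<And>x. x \<in> tuples n ?C \<Longrightarrow> x ! i = x ! j \<Longrightarrow> f x = term_function S n t x"
        using minors[OF ij(1-3)] by blast
      have "term_function S n t \<in> term_functions S n" using t by (auto simp: term_functions_def)
      then have "preserves n k (term_function S n t) R" using clone[OF n1] R by auto
      then have "map (\<lambda>l. term_function S n t (map (\<lambda>r. r ! l) rs)) [0..<k] \<in> R"
        using rs by (auto simp: preserves_def)
      moreover have "f (map (\<lambda>r. r ! l) rs) = term_function S n t (map (\<lambda>r. r ! l) rs)" if "l < k" for l
      proof (rule t(3))
        show "map (\<lambda>r. r ! l) rs \<in> tuples n ?C"
          using rs sub[OF R] nth_mem_carrier[of _ k ?C l] that by (auto simp: tuples_def subset_iff)
        show "map (\<lambda>r. r ! l) rs ! i = map (\<lambda>r. r ! l) rs ! j"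
          using ij rs by (simp add: tuples_def)
      qed
      then have "map (\<lambda>l. f (map (\<lambda>r. r ! l) rs)) [0..<k] = map (\<lambda>l. term_function S n t (map (\<lambda>r. r ! l) rs)) [0..<k]"
        by simp
      ultimately show "map (\<lambda>l. f (map (\<lambda>r. r ! l) rs)) [0..<k] \<in> R" by (simp only:)
    qed
    then show ?thesis using clone[OF n1] f by auto
  qed
  show ?thesis
  proof (intro exI allI ballI impI)
    fix n f
    assume "N \<le> n" "f \<in> tuples n ?C \<rightarrow>\<^sub>E ?C"
      and minors: "\<forall>i<n. \<forall>j<n. i \<noteq> j \<longrightarrow> (\<exists>t. t \<noteq> [] \<and> set t \<subseteq> {..<n} \<and>
        (\<forall>x\<in>tuples n ?C. x ! i = x ! j \<longrightarrow> f x = term_function S n t x))"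
    show "f \<in> term_functions S n"
      by (rule bound[OF \<open>N \<le> n\<close> \<open>f \<in> _\<close>]) (simp add: minors)
  qed
qed

section \<open>Amalgamation of words with few letters\<close>

text \<open>The weight of a letter is the number of its occurrences in the word to be found. Only the relative
  order of letters that have at most four occurrences together can be observed.\<close>

definition compatible :: "('b \<Rightarrow> nat) \<Rightarrow> 'b set \<Rightarrow> bool" where
  "compatible wt J \<longleftrightarrow> (\<forall>i\<in>J. \<forall>j\<in>J. i \<noteq> j \<longrightarrow> wt i + wt j \<le> 4)"

text \<open>Consider the first position at which two words differ. After restriction to the two letters found
  there the words still differ.\<close>

lemma eq_of_pair_filters:
  assumes "\<And>x y. x \<in> set u \<union> set v \<Longrightarrow> y \<in> set u \<union> set v \<Longrightarrow>
             filter (\<lambda>c. c \<in> {x, y}) u = filter (\<lambda>c. c \<in> {x, y}) v"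
  shows "u = v"
  using assms
proof (induction u arbitrary: v)
  case Nil
  show ?case
  proof (cases v)
    case (Cons y v')
    then show ?thesis using Nil[of y y] by auto
  qed simp
next
  case (Cons x u')
  have "filter (\<lambda>c. c \<in> {x, x}) (x # u') = filter (\<lambda>c. c \<in> {x, x}) v"
    by (rule Cons.prems) auto
  then obtain y v' where v: "v = y # v'" by (cases v) auto
  have xy: "x = y"
    using Cons.prems[of x y] v by (auto split: if_splits)
  have "u' = v'"
  proof (rule Cons.IH)
    fix c d assume "c \<in> set u' \<union> set v'" "d \<in> set u' \<union> set v'"
    then show "filter (\<lambda>e. e \<in> {c, d}) u' = filter (\<lambda>e. e \<in> {c, d}) v'"
      using Cons.prems[of c d] v xy by (auto split: if_splits)
  qed
  then show ?case using v xy by simp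
qed

lemma total_transitive_has_least:
  assumes "finite A" "A \<noteq> {}"
    and "\<And>x y. x \<in> A \<Longrightarrow> y \<in> A \<Longrightarrow> r x y \<or> r y x"
    and "\<And>x y z. x \<in> A \<Longrightarrow> y \<in> A \<Longrightarrow> z \<in> A \<Longrightarrow> r x y \<Longrightarrow> r y z \<Longrightarrow> r x z"
  shows "\<exists>x\<in>A. \<forall>y\<in>A. r x y"
  using assms
proof (induction rule: finite_ne_induct)
  case (singleton x)
  then show ?case by blast
next
  case (insert x F)
  have "\<exists>w\<in>F. \<forall>y\<in>F. r w y"
  proof (rule insert.IH)
    show "r u v \<or> r v u" if "u \<in> F" "v \<in> F" for u v using insert.prems(1) that by simp
    show "r u w" if "u \<in> F" "v \<in> F" "w \<in> F" "r u v" "r v w" for u v w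
      using insert.prems(2)[of u v w] that by simp
  qed
  then obtain w where w: "w \<in> F" "\<forall>y\<in>F. r w y" by blast
  show ?case
  proof (cases "r w x")
    case True then show ?thesis using w by auto
  next
    case False
    then have "r x w" using insert.prems(1)[of w x] w by auto
    then have "\<forall>y\<in>F. r x y" using insert.prems(2)[of x w] w by simp
    moreover have "r x x" using insert.prems(1)[of x x] by simp
    ultimately show ?thesis by auto
  qed
qed

lemma hd_filter: "w \<noteq> [] \<Longrightarrow> P (hd w) \<Longrightarrow> hd (filter P w) = hd w"
  by (cases w) auto

text \<open>\<open>W J\<close> prescribes the restriction of the word to be found to the letters of \<open>J\<close>. A triple may have
  more than four occurrences in total, so its word is an arbitrary witness that the prescriptions for
  its pairs can be realised simultaneously; conditions relate it to its pairs and single letters only.\<close>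

definition coherent :: "('b \<Rightarrow> nat) \<Rightarrow> 'b set \<Rightarrow> ('b set \<Rightarrow> 'b list) \<Rightarrow> bool" where
  "coherent wt I W \<longleftrightarrow> (\<forall>J\<subseteq>I. compatible wt J \<and> card J \<le> 3 \<longrightarrow>
     set (W J) \<subseteq> J \<and> (\<forall>K\<subseteq>J. card K \<le> 2 \<longrightarrow> filter (\<lambda>x. x \<in> K) (W J) = W K))"

lemma compatible_subset: "compatible wt J \<Longrightarrow> K \<subseteq> J \<Longrightarrow> compatible wt K"
  by (auto simp: compatible_def)

lemma coherent_subset:
  "coherent wt I W \<Longrightarrow> J \<subseteq> I \<Longrightarrow> compatible wt J \<Longrightarrow> card J \<le> 3 \<Longrightarrow> set (W J) \<subseteq> J"
  by (simp add: coherent_def)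

lemma coherent_filter:
  "coherent wt I W \<Longrightarrow> J \<subseteq> I \<Longrightarrow> compatible wt J \<Longrightarrow> card J \<le> 3 \<Longrightarrow> K \<subseteq> J \<Longrightarrow> card K \<le> 2 \<Longrightarrow>
   filter (\<lambda>x. x \<in> K) (W J) = W K"
  by (simp add: coherent_def)

text \<open>The word on all three letters begins with one of them, and the words on its pairs inherit this
  beginning.\<close>

lemma coherent_hd_trans:
  assumes "coherent wt I W" "x \<in> I" "y \<in> I" "z \<in> I" "compatible wt {x, y, z}"
    and ne: "W {x} \<noteq> []"
    and "hd (W {x, y}) = x" "hd (W {y, z}) = y"
  shows "hd (W {x, z}) = x"
proof -
  let ?J = "{x, y, z}" let ?w = "W ?J"
  have J: "set ?w \<subseteq> ?J" and K: "\<And>K. K \<subseteq> ?J \<Longrightarrow> card K \<le> 2 \<Longrightarrow> filter (\<lambda>x. x \<in> K) ?w = W K"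
    using assms(1-5) unfolding coherent_def by (auto simp: card_insert_if)
  have "?w \<noteq> []" using K[of "{x}"] ne by auto
  then have h: "hd ?w \<in> ?J" using J by (metis list.set_sel(1) subsetD)
  have *: "hd (W {c, d}) = hd ?w" if "c \<in> ?J" "d \<in> ?J" "hd ?w \<in> {c, d}" for c d
    using K[of "{c, d}"] that hd_filter[OF \<open>?w \<noteq> []\<close>, of "\<lambda>x. x \<in> {c, d}"]
    by (simp add: card_insert_if)
  show ?thesis using *[of x y] *[of y z] *[of x z] h assms(7,8) by auto
qed

text \<open>Let \<open>A\<close> be the set of remaining letters of weight at most 2. They are pairwise compatible, so \<open>A\<close>
  has a letter \<open>x\<close> that precedes all others in \<open>A\<close>. If \<open>x\<close> fails to precede some letter \<open>y\<close> compatible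
  with it, then \<open>y\<close> has weight 3 and \<open>x\<close> has weight 1. Such a \<open>y\<close> precedes all letters of weight 1 by
  transitivity through \<open>x\<close>, and is compatible with no others. If \<open>A\<close> is empty, no two remaining letters
  are compatible and any of them will do.\<close>

lemma coherent_first_letter:
  assumes fin: "finite I" and wt: "\<And>i. i \<in> I \<Longrightarrow> 1 \<le> wt i" and coh: "coherent wt I W"
    and ne: "\<exists>i\<in>I. W {i} \<noteq> []"
  shows "\<exists>x\<in>I. W {x} \<noteq> [] \<and> (\<forall>y\<in>I. compatible wt {x, y} \<longrightarrow> hd (W {x, y}) = x)"
proof -
  define I' where "I' = {i \<in> I. W {i} \<noteq> []}"
  define A where "A = {i \<in> I'. wt i \<le> 2}"
  define r where "r x y \<longleftrightarrow> hd (W {x, y}) = x" for x y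
  have I': "finite I'" "I' \<subseteq> I" "I' \<noteq> {}" "\<And>x. x \<in> I' \<Longrightarrow> W {x} \<noteq> []" using fin ne by (auto simp: I'_def)
  have comp: "compatible wt {x, y} \<longleftrightarrow> x = y \<or> wt x + wt y \<le> 4" for x y
    by (auto simp: compatible_def add.commute)
  have pair: "set (W {x, y}) \<subseteq> {x, y}" "filter (\<lambda>c. c \<in> {x}) (W {x, y}) = W {x}" "filter (\<lambda>c. c \<in> {y}) (W {x, y}) = W {y}"
    if "x \<in> I" "y \<in> I" "compatible wt {x, y}" for x y
    using coherent_subset[OF coh, of "{x, y}"] coherent_filter[OF coh, of "{x, y}" "{x}"]
      coherent_filter[OF coh, of "{x, y}" "{y}"] that by (auto simp: card_insert_if)
  have tot: "r x y \<or> r y x" if "x \<in> I'" "y \<in> I" "compatible wt {x, y}" for x y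
  proof -
    have xI: "x \<in> I" using that I'(2) by blast
    have "W {x, y} \<noteq> []" using pair(2)[OF xI that(2,3)] I'(4)[OF that(1)] by (metis filter.simps(1))
    then have "hd (W {x, y}) \<in> {x, y}" using pair(1)[OF xI that(2,3)] list.set_sel(1) by blast
    then show ?thesis by (auto simp: r_def insert_commute)
  qed
  have tr: "r x z" if "r x y" "r y z" "x \<in> I'" "y \<in> I" "z \<in> I" "compatible wt {x, y, z}" for x y z
    using coherent_hd_trans[OF coh, of x y z] that I' unfolding r_def by auto
  have outside: "r x y" if "x \<in> I'" "y \<in> I - I'" "compatible wt {x, y}" for x y
  proof -
    have xI: "x \<in> I" and yI: "y \<in> I" "W {y} = []" using that I'(2) by (auto simp: I'_def)
    have "W {x, y} \<noteq> []" using pair(2)[OF xI yI(1) that(3)] I'(4)[OF that(1)] by (metis filter.simps(1))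
    then have "hd (W {x, y}) \<in> set (W {x, y})" by simp
    moreover have "y \<notin> set (W {x, y})"
      using pair(3)[OF xI yI(1) that(3)] yI(2) by (auto simp: filter_empty_conv)
    ultimately show ?thesis unfolding r_def using pair(1)[OF xI yI(1) that(3)] by auto
  qed
  have refl: "r x x" if "x \<in> I'" for x using tot[of x x] that I'(2) comp[of x x] by auto
  have "\<exists>x\<in>I'. \<forall>y\<in>I'. compatible wt {x, y} \<longrightarrow> r x y"
  proof (cases "A = {}")
    case True
    obtain x where x: "x \<in> I'" using I'(3) by auto
    have "r x y" if y: "y \<in> I'" "compatible wt {x, y}" for y
    proof (rule ccontr)
      assume n: "\<not> r x y"
      then have "x \<noteq> y" using refl x by auto
      moreover have "wt x > 2" "wt y > 2" using True x y by (auto simp: A_def)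
      ultimately show False using y comp by auto
    qed
    then show ?thesis using x by blast
  next
    case False
    have compA: "compatible wt {x, y, w}" if "x \<in> A" "y \<in> A" "w \<in> A" for x y w
      using that by (auto simp: compatible_def A_def)
    have "\<exists>x\<in>A. \<forall>y\<in>A. r x y"
    proof (rule total_transitive_has_least)
      show "finite A" using I'(1) by (auto simp: A_def)
      show "r x y \<or> r y x" if "x \<in> A" "y \<in> A" for x y
        using tot[of x y] that compA[of x x y] I'(2) by (auto simp: A_def)
      show "r x w" if "x \<in> A" "y \<in> A" "w \<in> A" "r x y" "r y w" for x y w
        using tr[of x y w] that compA[of x y w] I'(2) by (auto simp: A_def)
    qed (rule False)
    then obtain x where x: "x \<in> A" "\<forall>y\<in>A. r x y" by auto
    show ?thesis
    proof (cases "\<exists>y\<in>I'. compatible wt {x, y} \<and> \<not> r x y")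
      case False
      then show ?thesis using x by (auto simp: A_def)
    next
      case True
      then obtain y where y: "y \<in> I'" "compatible wt {x, y}" "\<not> r x y" by auto
      have yA: "y \<notin> A" using x y by auto
      have "x \<noteq> y" using yA x by auto
      have wy: "wt y = 3" "wt x = 1"
        using y comp \<open>x \<noteq> y\<close> yA wt[of x] x I'(2) by (auto simp: A_def)
      have yx: "r y x" using tot[of x y] y x I'(2) by (auto simp: A_def)
      have "r y w" if w: "w \<in> I'" "compatible wt {y, w}" for w
      proof (cases "w = y")
        case True then show ?thesis using refl y by auto
      next
        case False
        then have ww: "wt w = 1" using w comp wy wt[of w] I'(2) by auto
        then have "w \<in> A" using w by (auto simp: A_def)
        then have "r x w" using x by auto
        moreover have "compatible wt {y, x, w}" using wy ww by (auto simp: compatible_def)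
        ultimately show ?thesis using tr[of y x w] yx y w x I'(2) by (auto simp: A_def)
      qed
      then show ?thesis using y by blast
    qed
  qed
  then obtain x where x: "x \<in> I'" "\<And>y. y \<in> I' \<Longrightarrow> compatible wt {x, y} \<Longrightarrow> r x y" by blast
  then have "\<And>y. y \<in> I \<Longrightarrow> compatible wt {x, y} \<Longrightarrow> r x y" using outside by blast
  then show ?thesis using x(1) I' unfolding r_def by blast
qed

lemma filter_mem_tl:
  "filter (\<lambda>c. c \<in> K) (x # w) = v \<Longrightarrow>
   filter (\<lambda>c. c \<in> K) w = (if x \<in> K then tl v else v)"
  by auto

lemma set_tl_subset: "set (tl w) \<subseteq> set w"
  by (cases w) auto

text \<open>If \<open>W J\<close> began with a letter other than \<open>x\<close>, the word on this letter and \<open>x\<close> would do so too.\<close>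

lemma coherent_strip:
  assumes coh: "coherent wt I W" and x: "x \<in> I" "W {x} \<noteq> []"
    and first: "\<And>y. y \<in> I \<Longrightarrow> compatible wt {x, y} \<Longrightarrow> hd (W {x, y}) = x"
    and J: "J \<subseteq> I" "compatible wt J" "card J \<le> 3" "x \<in> J"
  shows "W J = x # tl (W J)"
proof -
  have sub: "set (W J) \<subseteq> J" and K: "\<And>K. K \<subseteq> J \<Longrightarrow> card K \<le> 2 \<Longrightarrow> filter (\<lambda>x. x \<in> K) (W J) = W K"
    using coh J unfolding coherent_def by auto
  have ne: "W J \<noteq> []" using K[of "{x}"] x J by auto
  let ?y = "hd (W J)"
  have y: "?y \<in> J" using ne sub by (metis list.set_sel(1) subsetD)
  have "hd (W {x, ?y}) = ?y"
    using K[of "{x, ?y}"] y J(4) hd_filter[OF ne, of "\<lambda>c. c \<in> {x, ?y}"]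
    by (simp add: card_insert_if)
  moreover have "hd (W {x, ?y}) = x"
    using first[of ?y] y J compatible_subset[OF J(2), of "{x, ?y}"] by auto
  ultimately show ?thesis using ne by (metis list.collapse)
qed

text \<open>Greedy construction: choose a first letter, remove it from all prescribed words that contain it,
  which preserves coherence, and continue.\<close>

lemma amalgamation:
  assumes "finite I" "\<And>i. i \<in> I \<Longrightarrow> 1 \<le> wt i" "coherent wt I W"
  shows "\<exists>t. set t \<subseteq> I \<and>
    (\<forall>K\<subseteq>I. compatible wt K \<and> card K \<le> 2 \<longrightarrow> filter (\<lambda>x. x \<in> K) t = W K)"
  using assms(3)
proof (induction "\<Sum>i\<in>I. length (W {i})" arbitrary: W rule: less_induct)
  case less
  show ?case
  proof (cases "\<exists>i\<in>I. W {i} \<noteq> []")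
    case False
    have "W K = []" if K: "K \<subseteq> I" "compatible wt K" "card K \<le> 2" for K
    proof -
      have sub: "set (W K) \<subseteq> K" and f: "\<And>i. i \<in> K \<Longrightarrow> filter (\<lambda>x. x \<in> {i}) (W K) = W {i}"
        using coherent_subset[OF less.prems K(1,2)] coherent_filter[OF less.prems K(1,2), of "{_}"] K(3)
        by auto
      have nomem: "i \<notin> set (W K)" if "i \<in> K" for i
        using f[OF that] False that K(1) filter_empty_conv[of "\<lambda>x. x \<in> {i}" "W K"] by auto
      have "set (W K) = {}"
      proof (rule equals0I)
        show False if "c \<in> set (W K)" for c using sub nomem that by blast
      qed
      then show ?thesis by simp
    qed
    then show ?thesis by (intro exI[of _ "[]"]) auto
  next
    case True
    obtain x where x: "x \<in> I" "W {x} \<noteq> []"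
      and first: "\<And>y. y \<in> I \<Longrightarrow> compatible wt {x, y} \<Longrightarrow> hd (W {x, y}) = x"
      using coherent_first_letter[OF assms(1,2) less.prems True] by blast
    define W' where "W' K = (if x \<in> K then tl (W K) else W K)" for K
    have coh: "coherent wt I W'"
      unfolding coherent_def
    proof (intro allI impI conjI)
      fix J assume J: "J \<subseteq> I" "compatible wt J \<and> card J \<le> 3"
      then have sub: "set (W J) \<subseteq> J"
        and K: "\<And>K. K \<subseteq> J \<Longrightarrow> card K \<le> 2 \<Longrightarrow> filter (\<lambda>x. x \<in> K) (W J) = W K"
        using less.prems unfolding coherent_def by auto
      show "set (W' J) \<subseteq> J"
        using sub set_tl_subset[of "W J"] by (auto simp: W'_def)
      fix K assume "K \<subseteq> J" "card K \<le> 2"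
      note KK = K[OF this]
      show "filter (\<lambda>x. x \<in> K) (W' J) = W' K"
      proof (cases "x \<in> J")
        case True
        then have "W J = x # W' J"
          using coherent_strip[OF less.prems x first, of J] J by (simp add: W'_def)
        then show ?thesis using filter_mem_tl[of K x "W' J" "W K"] KK by (simp add: W'_def)
      next
        case False
        then show ?thesis using KK \<open>K \<subseteq> J\<close> by (auto simp: W'_def)
      qed
    qed
    have "(\<Sum>i\<in>I. length (W' {i})) < (\<Sum>i\<in>I. length (W {i}))"
      by (rule sum_strict_mono_ex1) (use assms(1) x in \<open>auto simp: W'_def\<close>)
    from less.hyps[OF this coh] obtain t where t: "set t \<subseteq> I"
      "\<And>K. K \<subseteq> I \<Longrightarrow> compatible wt K \<Longrightarrow> card K \<le> 2 \<Longrightarrow> filter (\<lambda>x. x \<in> K) t = W' K" by blast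
    have "filter (\<lambda>c. c \<in> K) (x # t) = W K" if K: "K \<subseteq> I" "compatible wt K" "card K \<le> 2" for K
    proof (cases "x \<in> K")
      case True
      then have "W K = x # W' K"
        using coherent_strip[OF less.prems x first, of K] K by (simp add: W'_def)
      then show ?thesis using t(2)[OF K] True by simp
    next
      case False
      then show ?thesis using t(2)[OF K] by (simp add: W'_def)
    qed
    then show ?thesis using x t(1) by (intro exI[of _ "x # t"]) auto
  qed
qed

section \<open>Words reconstructed from their minors\<close>

lemma filter_map_letters: "filter P (map \<rho> u) = map \<rho> (filter (\<lambda>i. P (\<rho> i)) u)"
  by (simp add: filter_map comp_def)

lemma length_filter_eq_sum:
  assumes "finite K"
  shows "length (filter (\<lambda>i. i \<in> K) w) = (\<Sum>i\<in>K. length (filter (\<lambda>j. j \<in> {i}) w))"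
  using assms
proof (induction K rule: finite_induct)
  case (insert i K)
  have "length (filter (\<lambda>j. j \<in> insert i K) w) =
     length (filter (\<lambda>j. j \<in> {i}) w) + length (filter (\<lambda>j. j \<in> K) w)"
    using \<open>i \<notin> K\<close> by (induction w) auto
  then show ?case using insert by simp
qed simp

text \<open>\<open>T \<phi>\<close> is a word for the minor along \<open>\<phi>\<close> of a fixed \<open>n\<close>-ary operation. Minors of minors are minors,
  but a word is determined by its term function only up to \<open>short_eq d\<close>. With \<open>N \<ge> 4\<close> there is room
  to keep three variables apart from each other and from the rest.\<close>

locale minor_words =
  fixes n N :: nat and d :: nat and T :: "(nat \<Rightarrow> nat) \<Rightarrow> nat list"
  assumes letters: "card (\<phi> ` {..<n}) \<le> N \<Longrightarrow> set (T \<phi>) \<subseteq> \<phi> ` {..<n}"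
    and minors: "card (\<chi> ` {..<n}) \<le> N \<Longrightarrow> (\<And>i. i < n \<Longrightarrow> \<phi> i = \<rho> (\<chi> i)) \<Longrightarrow>
           short_eq d (T \<phi>) (map \<rho> (T \<chi>))"
    and N: "4 \<le> N"
begin

lemma card_image_le_N: "card K \<le> 4 \<Longrightarrow> \<phi> ` {..<n} \<subseteq> K \<Longrightarrow> finite K \<Longrightarrow> card (\<phi> ` {..<n}) \<le> N"
  using card_mono[of K "\<phi> ` {..<n}"] N by linarith

text \<open>The joint number of occurrences of the variables in \<open>K\<close>, counted up to \<open>d\<close>. It is read off from the
  minor in the two variables 1 for \<open>K\<close> and 0 for its complement.\<close>

definition block_count :: "nat set \<Rightarrow> nat" where
  "block_count K = min d (length (filter (\<lambda>c. c = 1) (T (\<lambda>i. of_bool (i \<in> K)))))"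

definition weight :: "nat \<Rightarrow> nat" where "weight i = block_count {i}"

lemma block_count_eq:
  assumes "card (\<phi> ` {..<n}) \<le> N" "\<And>i. i < n \<Longrightarrow> i \<in> K \<longleftrightarrow> P (\<phi> i)"
  shows "block_count K = min d (length (filter P (T \<phi>)))"
proof -
  have "short_eq d (T (\<lambda>i. of_bool (i \<in> K))) (map (\<lambda>c. of_bool (P c)) (T \<phi>))"
    by (rule minors) (use assms in auto)
  from short_eq_min_length[OF this, of "\<lambda>c. c = 1"] show ?thesis
    by (simp add: block_count_def filter_map_letters)
qed

text \<open>Both sides are visible in the minor with three variables, for \<open>K\<close>, \<open>L\<close> and the rest.\<close>

lemma block_count_Un:
  assumes "K \<inter> L = {}"
  shows "block_count (K \<union> L) = min d (block_count K + block_count L)"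
proof -
  define \<phi> where "\<phi> i = (if i \<in> K then 0 else if i \<in> L then 1 else 2::nat)" for i :: nat
  have c: "card (\<phi> ` {..<n}) \<le> N"
    by (rule card_image_le_N[of "{0,1,2}"]) (auto simp: \<phi>_def)
  have "block_count K = min d (length (filter (\<lambda>c. c = 0) (T \<phi>)))"
       "block_count L = min d (length (filter (\<lambda>c. c = 1) (T \<phi>)))"
       "block_count (K \<union> L) = min d (length (filter (\<lambda>c. c = 0 \<or> c = 1) (T \<phi>)))"
    using assms by (auto intro!: block_count_eq c simp: \<phi>_def split: if_splits)
  moreover have "length (filter (\<lambda>c. c = 0 \<or> c = 1) w) =
      length (filter (\<lambda>c. c = 0) w) + length (filter (\<lambda>c. c = 1) w)" for w :: "nat list"
    by (induction w) auto
  ultimately show ?thesis by auto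
qed

lemma block_count_sum:
  assumes "K \<subseteq> {..<n}"
  shows "block_count K = min d (\<Sum>i\<in>K. weight i)"
proof -
  have "finite K" using assms finite_subset by blast
  then show ?thesis using assms
  proof (induction rule: finite_induct)
    case empty
    have "set (T (\<lambda>i. of_bool (i \<in> {}))) \<subseteq> {0}"
      using letters[of "\<lambda>i. of_bool (i \<in> {})"] card_image_le_N[of "{0}" "\<lambda>i. of_bool (i \<in> {})"] by auto
    then have "filter (\<lambda>c. c = 1) (T (\<lambda>i. of_bool (i \<in> {}))) = []"
      by (auto simp: filter_empty_conv)
    then show ?case by (simp add: block_count_def)
  next
    case (insert i K)
    then have "block_count ({i} \<union> K) = min d (weight i + block_count K)"
      unfolding weight_def by (intro block_count_Un) auto
    then show ?case using insert by auto
  qed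
qed

text \<open>Counted up to \<open>d\<close>, the occurrences of letters in any minor are the sums of the weights of the original
  variables. In particular, variables of weight 0 may be merged or renamed without leaving a trace.\<close>

lemma occurrences:
  assumes "card (\<phi> ` {..<n}) \<le> N"
  shows "min d (length (filter P (T \<phi>))) = min d (\<Sum>i | i < n \<and> P (\<phi> i). weight i)"
  using block_count_eq[OF assms, of "{i. i < n \<and> P (\<phi> i)}" P]
    block_count_sum[of "{i. i < n \<and> P (\<phi> i)}"] by auto

text \<open>The name \<open>n\<close>, not used by any of the variables \<open>0, \<dots>, n - 1\<close>, stands for all variables outside \<open>J\<close>.\<close>

definition isolate :: "nat set \<Rightarrow> nat \<Rightarrow> nat" where
  "isolate J i = (if i \<in> J then i else n)"

definition local_word :: "nat set \<Rightarrow> nat list" where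
  "local_word J = filter (\<lambda>i. i \<in> J) (T (isolate J))"

lemma card_isolate: "finite J \<Longrightarrow> card J \<le> 3 \<Longrightarrow> card (isolate J ` {..<n}) \<le> N"
  by (rule card_image_le_N[of "insert n J"]) (auto simp: isolate_def card_insert_if)

text \<open>The minor that isolates \<open>K\<close> arises from every finer minor, and a total weight below \<open>d\<close> makes the
  restriction to \<open>K\<close> short enough to be determined exactly.\<close>

lemma local_word_eq:
  assumes \<chi>: "card (\<chi> ` {..<n}) \<le> N" "\<And>i. i < n \<Longrightarrow> isolate K i = isolate K (\<chi> i)"
    and K: "K \<subseteq> {..<n}" "(\<Sum>i\<in>K. weight i) < d" "card K \<le> 3"
  shows "local_word K = filter (\<lambda>i. i \<in> K) (T \<chi>)"
proof -
  have fin: "finite K" using K(1) finite_subset by blast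
  have iff: "isolate K i \<in> K \<longleftrightarrow> i \<in> K" for i using K(1) by (auto simp: isolate_def)
  have "{i. i < n \<and> isolate K i \<in> K} = K" using K(1) by (auto simp: iff)
  then have "min d (length (local_word K)) = min d (\<Sum>i\<in>K. weight i)"
    using occurrences[OF card_isolate[OF fin K(3)], of "\<lambda>i. i \<in> K"]
    by (simp add: local_word_def)
  then have "length (local_word K) < d" using K(2) by auto
  moreover have "short_eq d (T (isolate K)) (map (isolate K) (T \<chi>))"
    by (rule minors) (use \<chi> in auto)
  ultimately have "local_word K = filter (\<lambda>i. i \<in> K) (map (isolate K) (T \<chi>))"
    unfolding local_word_def by (intro short_eqD) auto
  also have "\<dots> = map (isolate K) (filter (\<lambda>i. i \<in> K) (T \<chi>))"
    by (simp add: filter_map_letters iff)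
  also have "\<dots> = filter (\<lambda>i. i \<in> K) (T \<chi>)"
    by (rule map_idI) (auto simp: isolate_def)
  finally show ?thesis .
qed

lemma min_length_local_word:
  assumes "i < n"
  shows "min d (length (local_word {i})) = weight i"
proof -
  have "{j. j < n \<and> isolate {i} j \<in> {i}} = {i}" using assms by (auto simp: isolate_def)
  moreover have "weight i \<le> d" by (simp add: weight_def block_count_def)
  ultimately show ?thesis
    using occurrences[OF card_isolate[of "{i}"], of "\<lambda>j. j \<in> {i}"]
    by (simp add: local_word_def min_absorb2)
qed

end

locale minor_words5 = minor_words n N 5 T for n N T
begin

text \<open>A proper nonempty subset \<open>K\<close> with at most two elements of a compatible set \<open>J\<close> has total weight at most
  4: this is compatibility if \<open>K\<close> is a pair, and if \<open>K\<close> is a single letter, its weight together with that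
  of another letter of \<open>J\<close> is at most 4.\<close>

lemma coherent_local_words:
  "coherent weight {i. i < n \<and> weight i \<noteq> 0} local_word"
  unfolding coherent_def
proof (intro allI impI conjI)
  fix J assume J: "J \<subseteq> {i. i < n \<and> weight i \<noteq> 0}" "compatible weight J \<and> card J \<le> 3"
  then have fin: "finite J" by (metis (no_types, lifting) finite_Collect_less_nat finite_subset mem_Collect_eq subsetI subsetD)
  show "set (local_word J) \<subseteq> J" by (auto simp: local_word_def)
  fix K assume K: "K \<subseteq> J" "card K \<le> 2"
  show "filter (\<lambda>x. x \<in> K) (local_word J) = local_word K"
  proof (cases "K = J \<or> K = {}")
    case True
    then show ?thesis by (auto simp: local_word_def)
  next
    case False
    have finK: "finite K" using K fin finite_subset by blast
    have small: "(\<Sum>i\<in>K. weight i) < 5"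
    proof (cases "\<exists>i j. i \<noteq> j \<and> K = {i, j}")
      case True
      then obtain i j where ij: "i \<noteq> j" "K = {i, j}" by blast
      then have "weight i + weight j \<le> 4" using J K by (auto simp: compatible_def)
      then show ?thesis using ij by simp
    next
      case no: False
      have "card K \<noteq> 2" using no by (auto simp: card_2_iff)
      moreover have "card K \<noteq> 0" using False finK by auto
      ultimately have "card K = 1" using K by linarith
      then obtain i where i: "K = {i}" by (auto simp: card_1_singleton_iff)
      then obtain j where "j \<in> J" "j \<noteq> i" using False K by auto
      then show ?thesis using i J K by (fastforce simp: compatible_def)
    qed
    have "local_word K = filter (\<lambda>i. i \<in> K) (T (isolate J))"
    proof (rule local_word_eq)
      show "card (isolate J ` {..<n}) \<le> N" using card_isolate fin J by auto
      show "isolate K i = isolate K (isolate J i)" if "i < n" for i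
        using K J that by (auto simp: isolate_def)
    qed (use small K J in auto)
    then show ?thesis using K by (auto simp: local_word_def intro!: filter_cong)
  qed
qed

text \<open>Let \<open>P\<close> be a set of letters that has at most four occurrences in the minor along \<open>\<phi>\<close>, and \<open>Q\<close> the
  set of original variables of positive weight that \<open>\<phi>\<close> maps to \<open>P\<close>. Then \<open>Q\<close> has at most four
  elements, so passing to a finer minor that separates them needs only four additional variables. In
  this minor the letters from \<open>Q\<close> form a word that agrees with \<open>t\<close> on all pairs, hence altogether.\<close>

lemma global_word:
  assumes \<phi>: "card (\<phi> ` {..<n}) + 4 \<le> N"
    and t: "set t \<subseteq> {i. i < n \<and> weight i \<noteq> 0}"
      "\<And>K. K \<subseteq> {i. i < n \<and> weight i \<noteq> 0} \<Longrightarrow> compatible weight K \<Longrightarrow> card K \<le> 2 \<Longrightarrow>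
           filter (\<lambda>x. x \<in> K) t = local_word K"
  shows "short_eq 5 (T \<phi>) (map \<phi> t)"
  unfolding short_eq_def
proof (intro allI impI)
  fix P
  assume short: "length (filter P (T \<phi>)) < 5 \<or> length (filter P (map \<phi> t)) < 5"
  define Q where "Q = {i. i < n \<and> weight i \<noteq> 0 \<and> P (\<phi> i)}"
  have finQ: "finite Q" by (simp add: Q_def)
  have QI: "Q \<subseteq> {i. i < n \<and> weight i \<noteq> 0}" by (auto simp: Q_def)
  have len_t: "length (filter (\<lambda>i. i \<in> K) t) = (\<Sum>i\<in>K. length (local_word {i}))"
    if "K \<subseteq> {i. i < n \<and> weight i \<noteq> 0}" for K
  proof -
    have "finite K" using that finite_subset[of K "{..<n}"] by auto
    then have "length (filter (\<lambda>i. i \<in> K) t) = (\<Sum>i\<in>K. length (filter (\<lambda>j. j \<in> {i}) t))"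
      by (rule length_filter_eq_sum)
    also have "\<dots> = (\<Sum>i\<in>K. length (local_word {i}))"
      using that t(2)[of "{_}"] by (intro sum.cong) (auto simp: compatible_def)
    finally show ?thesis .
  qed
  have filter_t: "filter (\<lambda>i. P (\<phi> i)) t = filter (\<lambda>i. i \<in> Q) t"
    using t(1) by (auto simp: Q_def intro!: filter_cong)
  have min_sum: "min 5 (\<Sum>i\<in>K. f i) = min 5 (\<Sum>i\<in>K. min 5 (f i))" if "finite K" for K and f :: "nat \<Rightarrow> nat"
    using that by (induction rule: finite_induct) auto
  have sumQ: "(\<Sum>i | i < n \<and> P (\<phi> i). weight i) = (\<Sum>i\<in>Q. weight i)"
    by (rule sum.mono_neutral_right) (auto simp: Q_def)
  have "min 5 (length (filter P (map \<phi> t))) = min 5 (\<Sum>i\<in>Q. length (local_word {i}))"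
    using len_t[OF QI] by (simp add: filter_map_letters filter_t)
  also have "\<dots> = min 5 (\<Sum>i\<in>Q. min 5 (length (local_word {i})))"
    by (rule min_sum[OF finQ])
  also have "(\<Sum>i\<in>Q. min 5 (length (local_word {i}))) = (\<Sum>i\<in>Q. weight i)"
    by (rule sum.cong) (auto simp: Q_def min_length_local_word)
  also have "min 5 (\<Sum>i\<in>Q. weight i) = min 5 (length (filter P (T \<phi>)))"
    using occurrences[of \<phi> P] \<phi> sumQ by simp
  finally have "min 5 (length (filter P (map \<phi> t))) = min 5 (length (filter P (T \<phi>)))"
    and "min 5 (\<Sum>i\<in>Q. weight i) = min 5 (length (filter P (T \<phi>)))" 
    using occurrences[of \<phi> P] \<phi> sumQ by auto
  then have small: "(\<Sum>i\<in>Q. weight i) < 5" and shortT: "length (filter P (T \<phi>)) < 5"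
    using short by auto
  have "card Q \<le> (\<Sum>i\<in>Q. weight i)"
    unfolding card_eq_sum by (rule sum_mono) (auto simp: Q_def)
  then have cardQ: "card Q \<le> 4" using small by simp
  \<comment> \<open>Refine \<open>\<phi>\<close> so that the variables in \<open>Q\<close> keep their names. The shift by \<open>n\<close> keeps the
    remaining letters apart from these.\<close>
  define \<chi> where "\<chi> i = (if i \<in> Q then i else n + \<phi> i)" for i
  define \<rho> where "\<rho> j = (if j < n then \<phi> j else j - n)" for j
  have card\<chi>: "card (\<chi> ` {..<n}) \<le> N"
  proof -
    have "\<chi> ` {..<n} \<subseteq> Q \<union> (\<lambda>x. n + x) ` \<phi> ` {..<n}" by (auto simp: \<chi>_def)
    then have "card (\<chi> ` {..<n}) \<le> card (Q \<union> (\<lambda>x. n + x) ` \<phi> ` {..<n})"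
      by (rule card_mono[rotated]) (simp add: finQ)
    also have "\<dots> \<le> card Q + card ((\<lambda>x. n + x) ` \<phi> ` {..<n})" by (rule card_Un_le)
    also have "\<dots> \<le> 4 + card (\<phi> ` {..<n})" using cardQ card_image_le[of "\<phi> ` {..<n}" "\<lambda>x. n + x"] by simp
    finally show ?thesis using \<phi> by simp
  qed
  have "short_eq 5 (T \<phi>) (map \<rho> (T \<chi>))"
    by (rule minors[OF card\<chi>]) (auto simp: \<rho>_def \<chi>_def Q_def)
  then have "filter P (T \<phi>) = filter P (map \<rho> (T \<chi>))"
    by (rule short_eqD) (use shortT in auto)
  also have "\<dots> = map \<rho> (filter (\<lambda>i. P (\<rho> i)) (T \<chi>))" by (rule filter_map_letters)
  also have "filter (\<lambda>i. P (\<rho> i)) (T \<chi>) = filter (\<lambda>i. i \<in> Q) (T \<chi>)"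
  proof -
    have "{i. i < n \<and> \<chi> i \<notin> Q \<and> P (\<rho> (\<chi> i))} = {i. i < n \<and> i \<notin> Q \<and> P (\<phi> i)}"
      by (auto simp: \<chi>_def \<rho>_def Q_def)
    then have "(\<Sum>i | i < n \<and> \<chi> i \<notin> Q \<and> P (\<rho> (\<chi> i)). weight i) = 0"
      by (auto simp: Q_def)
    then have none: "filter (\<lambda>c. c \<notin> Q \<and> P (\<rho> c)) (T \<chi>) = []"
      using occurrences[OF card\<chi>, of "\<lambda>c. c \<notin> Q \<and> P (\<rho> c)"] by (simp add: min_def split: if_splits)
    have "P (\<rho> c)" if "c \<in> Q" for c using that by (auto simp: Q_def \<rho>_def)
    then show ?thesis using none by (auto simp: filter_empty_conv intro!: filter_cong)
  qed
  also have "filter (\<lambda>i. i \<in> Q) (T \<chi>) = filter (\<lambda>i. i \<in> Q) t"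
  proof (rule eq_of_pair_filters)
    fix i j assume "i \<in> set (filter (\<lambda>i. i \<in> Q) (T \<chi>)) \<union> set (filter (\<lambda>i. i \<in> Q) t)"
      "j \<in> set (filter (\<lambda>i. i \<in> Q) (T \<chi>)) \<union> set (filter (\<lambda>i. i \<in> Q) t)"
    then have ij: "{i, j} \<subseteq> Q" by auto
    have s: "(\<Sum>k\<in>{i, j}. weight k) < 5"
      using sum_mono2[OF finQ ij, of weight] small by linarith
    have c2: "card {i, j} \<le> 2" by (simp add: card_insert_if)
    have "local_word {i, j} = filter (\<lambda>c. c \<in> {i, j}) (T \<chi>)"
    proof (rule local_word_eq[OF card\<chi>])
      show "isolate {i, j} k = isolate {i, j} (\<chi> k)" if "k < n" for k
        using ij that by (auto simp: isolate_def \<chi>_def Q_def)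
    qed (use s c2 ij in \<open>auto simp: Q_def\<close>)
    moreover have "filter (\<lambda>c. c \<in> {i, j}) t = local_word {i, j}"
    proof (rule t(2))
      show "compatible weight {i, j}"
        using s by (auto simp: compatible_def split: if_splits)
    qed (use ij c2 in \<open>auto simp: Q_def\<close>)
    moreover have "filter (\<lambda>c. c \<in> {i, j}) (filter (\<lambda>c. c \<in> Q) w) = filter (\<lambda>c. c \<in> {i, j}) w" for w
      using ij by (auto intro!: filter_cong)
    ultimately show "filter (\<lambda>c. c \<in> {i, j}) (filter (\<lambda>i. i \<in> Q) (T \<chi>)) =
        filter (\<lambda>c. c \<in> {i, j}) (filter (\<lambda>i. i \<in> Q) t)" by simp
  qed
  also have "map \<rho> (filter (\<lambda>i. i \<in> Q) t) = map \<phi> (filter (\<lambda>i. i \<in> Q) t)"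
    by (auto simp: \<rho>_def Q_def)
  also have "\<dots> = filter P (map \<phi> t)" by (simp add: filter_map_letters filter_t)
  finally show "filter P (T \<phi>) = filter P (map \<phi> t)" .
qed

lemma minors_amalgamate:
  "\<exists>t. set t \<subseteq> {..<n} \<and> (\<forall>\<phi>. card (\<phi> ` {..<n}) + 4 \<le> N \<longrightarrow> short_eq 5 (T \<phi>) (map \<phi> t))"
proof -
  let ?I = "{i. i < n \<and> weight i \<noteq> 0}"
  obtain t where t: "set t \<subseteq> ?I"
    "\<forall>K\<subseteq>?I. compatible weight K \<and> card K \<le> 2 \<longrightarrow> filter (\<lambda>x. x \<in> K) t = local_word K"
    using amalgamation[OF _ _ coherent_local_words] by auto
  have "short_eq 5 (T \<phi>) (map \<phi> t)" if "card (\<phi> ` {..<n}) + 4 \<le> N" for \<phi>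
    using global_word[OF that t(1)] t(2) by blast
  then show ?thesis using t(1) by (intro exI[of _ t]) auto
qed

end

section \<open>Zero-direct unions\<close>

text \<open>On a zero-direct union this collapses the other part to zero.\<close>

definition retract :: "'s semigrp \<Rightarrow> 's \<Rightarrow> 's \<Rightarrow> 's" where
  "retract S z x = (if x \<in> carrier S then x else z)"

locale zero_union =
  fixes S T U :: "'s semigrp" and z :: 's
  assumes sgS: "is_semigroup S" and sgT: "is_semigroup T"
    and zS: "is_zero S z" and zT: "is_zero T z"
    and inter: "carrier S \<inter> carrier T = {z}"
    and U: "U = zero_direct_union z S T"
begin

lemma in_both: "x \<in> carrier S \<Longrightarrow> x \<in> carrier T \<Longrightarrow> x = z" using inter by blast

lemma z_mem [simp]: "z \<in> carrier S" "z \<in> carrier T" "carrier S \<noteq> {}" "carrier T \<noteq> {}"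
  using inter by blast+

lemma z_mult [simp]:
  "x \<in> carrier S \<Longrightarrow> x \<odot>\<^bsub>S\<^esub> z = z" "x \<in> carrier S \<Longrightarrow> z \<odot>\<^bsub>S\<^esub> x = z"
  "x \<in> carrier T \<Longrightarrow> x \<odot>\<^bsub>T\<^esub> z = z" "x \<in> carrier T \<Longrightarrow> z \<odot>\<^bsub>T\<^esub> x = z"
  using zS zT by (auto simp: is_zero_def)

lemma carrier_U: "carrier U = carrier S \<union> carrier T"
  using zS zT by (auto simp: U zero_direct_union_def with_zero_def)

lemma mult_U: "x \<odot>\<^bsub>U\<^esub> y =
    (if x \<in> carrier S \<and> y \<in> carrier S then x \<odot>\<^bsub>S\<^esub> y
     else if x \<in> carrier T \<and> y \<in> carrier T then x \<odot>\<^bsub>T\<^esub> y else z)"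
  using zS zT by (auto simp: U zero_direct_union_def with_zero_def)

lemma mult_closed:
  "x \<in> carrier S \<Longrightarrow> y \<in> carrier S \<Longrightarrow> x \<odot>\<^bsub>S\<^esub> y \<in> carrier S"
  "x \<in> carrier T \<Longrightarrow> y \<in> carrier T \<Longrightarrow> x \<odot>\<^bsub>T\<^esub> y \<in> carrier T"
  using is_semigroup.m_closed[OF sgS] is_semigroup.m_closed[OF sgT] by auto

lemma mult_U_S: "x \<in> carrier S \<Longrightarrow> y \<in> carrier S \<Longrightarrow> x \<odot>\<^bsub>U\<^esub> y = x \<odot>\<^bsub>S\<^esub> y"
  by (simp add: mult_U)

lemma mult_U_T: 
  assumes "x \<in> carrier T" "y \<in> carrier T" shows "x \<odot>\<^bsub>U\<^esub> y = x \<odot>\<^bsub>T\<^esub> y"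
proof (cases "x \<in> carrier S \<and> y \<in> carrier S")
  case True
  then have "x = z" "y = z" using assms in_both by auto
  then show ?thesis by (simp add: mult_U)
next
  case False
  then show ?thesis using assms unfolding mult_U by auto
qed

lemma U_closed: "x \<in> carrier U \<Longrightarrow> y \<in> carrier U \<Longrightarrow> x \<odot>\<^bsub>U\<^esub> y \<in> carrier U"
  using mult_closed[of x y] by (auto simp: carrier_U mult_U)

lemma retract_mem [simp]: "retract S z x \<in> carrier S" "retract T z x \<in> carrier T"
  by (auto simp: retract_def)

lemma retract_S_mult:
  assumes "x \<in> carrier U" "y \<in> carrier U"
  shows "retract S z (x \<odot>\<^bsub>U\<^esub> y) = retract S z x \<odot>\<^bsub>S\<^esub> retract S z y"
proof (cases "x \<in> carrier S \<and> y \<in> carrier S")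
  case True
  then show ?thesis by (simp add: mult_U_S retract_def mult_closed)
next
  case False
  have "x \<odot>\<^bsub>U\<^esub> y \<in> carrier T" using False mult_closed(2)[of x y] by (auto simp: mult_U)
  then have "retract S z (x \<odot>\<^bsub>U\<^esub> y) = z" using in_both by (auto simp: retract_def)
  also have "z = retract S z x \<odot>\<^bsub>S\<^esub> retract S z y" using False by (auto simp: retract_def)
  finally show ?thesis .
qed

lemma retract_T_mult:
  assumes "x \<in> carrier U" "y \<in> carrier U"
  shows "retract T z (x \<odot>\<^bsub>U\<^esub> y) = retract T z x \<odot>\<^bsub>T\<^esub> retract T z y"
proof (cases "x \<in> carrier T \<and> y \<in> carrier T")
  case True
  then show ?thesis by (simp add: mult_U_T retract_def mult_closed)
next
  case False
  have "x \<odot>\<^bsub>U\<^esub> y \<in> carrier S" using False mult_closed(1)[of x y] by (auto simp: mult_U)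
  then have "retract T z (x \<odot>\<^bsub>U\<^esub> y) = z" using in_both by (auto simp: retract_def)
  also have "z = retract T z x \<odot>\<^bsub>T\<^esub> retract T z y" using False by (auto simp: retract_def)
  finally show ?thesis .
qed

text \<open>Together with the fact that the two retractions are homomorphisms, this embeds \<open>U\<close> into \<open>S \<times> T\<close>.\<close>

lemma retracts_separate:
  assumes "x \<in> carrier U" "y \<in> carrier U"
    and "retract S z x = retract S z y" "retract T z x = retract T z y"
  shows "x = y"
  using assms by (auto simp: carrier_U retract_def split: if_splits)

lemma is_semigroup_U: "is_semigroup U"
proof
  show "carrier U \<noteq> {}" by (simp add: carrier_U)
  show "x \<odot>\<^bsub>U\<^esub> y \<in> carrier U" if "x \<in> carrier U" "y \<in> carrier U" for x y using that by (rule U_closed)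
  show "x \<odot>\<^bsub>U\<^esub> y \<odot>\<^bsub>U\<^esub> w = x \<odot>\<^bsub>U\<^esub> (y \<odot>\<^bsub>U\<^esub> w)"
    if "x \<in> carrier U" "y \<in> carrier U" "w \<in> carrier U" for x y w
    by (rule retracts_separate)
      (use that in \<open>simp_all add: retract_S_mult retract_T_mult U_closed
        is_semigroup.m_assoc[OF sgS] is_semigroup.m_assoc[OF sgT]\<close>)
qed

lemma retract_word_product:
  assumes "t \<noteq> []" "\<And>i. i \<in> set t \<Longrightarrow> y i \<in> carrier U"
  shows "retract S z (word_product U (map y t)) = word_product S (map (\<lambda>i. retract S z (y i)) t)"
    and "retract T z (word_product U (map y t)) = word_product T (map (\<lambda>i. retract T z (y i)) t)"
proof -
  have "retract S z (word_product U (map y t)) = word_product S (map (\<lambda>i. retract S z (y i)) t) \<and>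
    retract T z (word_product U (map y t)) = word_product T (map (\<lambda>i. retract T z (y i)) t)"
    using assms
  proof (induction t rule: list_nonempty_induct)
    case (cons i t)
    have "word_product U (map y t) \<in> carrier U"
      using cons by (intro is_semigroup.word_product_closed[OF is_semigroup_U]) auto
    then show ?case
      using cons by (simp add: word_product_Cons retract_S_mult retract_T_mult)
  qed simp
  then show "retract S z (word_product U (map y t)) = word_product S (map (\<lambda>i. retract S z (y i)) t)"
    "retract T z (word_product U (map y t)) = word_product T (map (\<lambda>i. retract T z (y i)) t)" by auto
qed

lemma word_product_U_T:
  assumes "t \<noteq> []" "\<And>i. i \<in> set t \<Longrightarrow> y i \<in> carrier T"
  shows "word_product U (map y t) = word_product T (map y t)"
  using assms
proof (induction t rule: list_nonempty_induct)
  case (cons i t)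
  have "word_product T (map y t) \<in> carrier T"
    using cons by (intro is_semigroup.word_product_closed[OF sgT]) auto
  then show ?case using cons by (simp add: word_product_Cons mult_U_T)
qed simp

end

text \<open>As \<open>S\<close> satisfies the identities of \<open>T\<close>, a word for a minor is determined up to \<open>short_eq 5\<close> by its
  term function on \<open>T\<close>, and in turn determines the term function on all of \<open>U\<close>. An argument tuple
  from \<open>U\<close> has at most \<open>|U|\<close> different entries. So the operation is known from its minors in \<open>|U|\<close>
  variables, and four more variables are needed for the reconstruction of a word.\<close>

lemma (in zero_union) finitely_related_U:
  assumes T: "presented T (nil_eq 5) vT"
    and S: "presented S \<kappa> vS" and \<kappa>: "\<And>x y. nil_eq 5 x y \<Longrightarrow> \<kappa> x y"
    and fin: "finite (carrier U)"
  shows "finitely_related U"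
proof (rule finitely_relatedI[OF is_semigroup_U fin])
  define N where "N = card (carrier U) + 4"
  show "1 \<le> N" by (simp add: N_def)
  have U_eq: "word_product U (map y u) = word_product U (map y w)"
    if "short_eq 5 u w" "u \<noteq> []" "w \<noteq> []" "\<And>i. y i \<in> carrier U" for u w and y :: "nat \<Rightarrow> 's"
  proof (rule retracts_separate)
    show "word_product U (map y u) \<in> carrier U" "word_product U (map y w) \<in> carrier U"
      using that(2-4) by (auto intro!: is_semigroup.word_product_closed[OF is_semigroup_U])
    show "retract S z (word_product U (map y u)) = retract S z (word_product U (map y w))"
      using short_eq_word_product[OF S \<kappa> that(1-3), of "\<lambda>i. retract S z (y i)"]
      by (simp add: retract_word_product that)
    show "retract T z (word_product U (map y u)) = retract T z (word_product U (map y w))"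
      using short_eq_word_product[OF T _ that(1-3), of "\<lambda>i. retract T z (y i)"]
      by (simp add: retract_word_product that)
  qed
  have T_eq: "short_eq 5 u w"
    if "\<And>y. (\<And>i. y i \<in> carrier T) \<Longrightarrow> word_product U (map y u) = word_product U (map y w)" "u \<noteq> []" "w \<noteq> []"
    for u w :: "nat list"
  proof (rule short_eq_of_evaluations)
    fix y :: "nat \<Rightarrow> bool list"
    have vT: "vT x \<in> carrier T" for x by (auto simp: presentedD(1)[OF T])
    have "word_product U (map (\<lambda>i. vT (y i)) u) = word_product U (map (\<lambda>i. vT (y i)) w)"
      by (rule that(1)) (rule vT)
    then have "word_product T (map (\<lambda>i. vT (y i)) u) = word_product T (map (\<lambda>i. vT (y i)) w)"
      using that(2,3) vT by (simp add: word_product_U_T)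
    then show "nil_eq 5 (concat (map y u)) (concat (map y w))"
      using word_product_presented[OF T that(2)] word_product_presented[OF T that(3)]
      by (simp add: presentedD(3)[OF T])
  qed
  fix n f
  assume n: "1 \<le> n"
    and "\<And>\<phi>. card (\<phi> ` {..<n}) \<le> N \<Longrightarrow> \<exists>w. minor_word U n f \<phi> w"
  then obtain W where W: "\<And>\<phi>. card (\<phi> ` {..<n}) \<le> N \<Longrightarrow> minor_word U n f \<phi> (W \<phi>)" by metis
  interpret minor_words5 n N W
  proof
    show "4 \<le> N" by (simp add: N_def)
    show "set (W \<phi>) \<subseteq> \<phi> ` {..<n}" if "card (\<phi> ` {..<n}) \<le> N" for \<phi>
      using W[OF that] by (simp add: minor_word_def)
    show "short_eq 5 (W \<phi>) (map \<rho> (W \<chi>))"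
      if \<chi>: "card (\<chi> ` {..<n}) \<le> N" and \<rho>: "\<And>i. i < n \<Longrightarrow> \<phi> i = \<rho> (\<chi> i)" for \<phi> \<chi> \<rho>
    proof (rule T_eq)
      have "\<phi> ` {..<n} = \<rho> ` \<chi> ` {..<n}" using \<rho> by (auto simp: image_iff)
      then have "card (\<phi> ` {..<n}) \<le> N" using \<chi> card_image_le[of "\<chi> ` {..<n}" \<rho>] by simp
      note W = W[OF this] W[OF \<chi>]
      show "W \<phi> \<noteq> []" "map \<rho> (W \<chi>) \<noteq> []" using W by (auto simp: minor_word_def)
      fix y :: "nat \<Rightarrow> 's" assume "\<And>i. y i \<in> carrier T"
      then have y: "\<forall>i. y i \<in> carrier U" by (simp add: carrier_U)
      have "word_product U (map y (W \<phi>)) = f (map (\<lambda>i. y (\<phi> i)) [0..<n])"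
        using W(1) y unfolding minor_word_def by metis
      also have "map (\<lambda>i. y (\<phi> i)) [0..<n] = map (\<lambda>i. (y \<circ> \<rho>) (\<chi> i)) [0..<n]"
        using \<rho> by simp
      also have "f \<dots> = word_product U (map (y \<circ> \<rho>) (W \<chi>))"
      proof -
        have "\<forall>i. (y \<circ> \<rho>) i \<in> carrier U" using y by simp
        then show ?thesis using W(2) unfolding minor_word_def by blast
      qed
      finally show "word_product U (map y (W \<phi>)) = word_product U (map y (map \<rho> (W \<chi>)))" by simp
    qed
  qed
  obtain t where t: "set t \<subseteq> {..<n}"
    "\<And>\<phi>. card (\<phi> ` {..<n}) + 4 \<le> N \<Longrightarrow> short_eq 5 (W \<phi>) (map \<phi> t)"
    using minors_amalgamate by blast
  obtain \<iota> :: "'s \<Rightarrow> nat" where \<iota>: "inj_on \<iota> (carrier U)"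
    using finite_imp_inj_to_nat_seg[OF fin] by blast
  have main: "t \<noteq> [] \<and> f (map y [0..<n]) = word_product U (map y t)" if y: "\<forall>i. y i \<in> carrier U"
    for y :: "nat \<Rightarrow> 's"
  proof -
    define \<phi> where "\<phi> i = \<iota> (y i)" for i
    define g where "g j = (if j \<in> \<iota> ` carrier U then inv_into (carrier U) \<iota> j else z)" for j
    have g: "\<forall>j. g j \<in> carrier U" using inv_into_into[of _ \<iota> "carrier U"] by (auto simp: g_def carrier_U)
    have gy: "g (\<phi> i) = y i" for i using y \<iota> by (simp add: g_def \<phi>_def)
    have "\<phi> ` {..<n} \<subseteq> \<iota> ` carrier U" using y by (auto simp: \<phi>_def)
    then have "card (\<phi> ` {..<n}) \<le> card (carrier U)"
      using card_mono[of "\<iota> ` carrier U"] card_image[OF \<iota>] fin by fastforce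
    then have \<phi>: "card (\<phi> ` {..<n}) + 4 \<le> N" by (simp add: N_def)
    have W\<phi>: "minor_word U n f \<phi> (W \<phi>)" using W \<phi> by simp
    then have "W \<phi> \<noteq> []" by (simp add: minor_word_def)
    moreover have "short_eq 5 (W \<phi>) (map \<phi> t)" by (rule t(2)[OF \<phi>])
    ultimately have ne: "t \<noteq> []" using short_eqD[of 5 "W \<phi>" "map \<phi> t" "\<lambda>_. True"] by auto
    have "f (map (\<lambda>i. g (\<phi> i)) [0..<n]) = word_product U (map g (W \<phi>))"
      using W\<phi> g by (auto simp: minor_word_def)
    also have "\<dots> = word_product U (map g (map \<phi> t))"
      using U_eq[of "W \<phi>" "map \<phi> t" g] t(2)[OF \<phi>] \<open>W \<phi> \<noteq> []\<close> ne g by simp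
    finally show ?thesis using ne by (simp add: gy comp_def)
  qed
  have "\<forall>i::nat. z \<in> carrier U" by (simp add: carrier_U)
  then have "t \<noteq> []" using main[of "\<lambda>_. z"] by blast
  then have "minor_word U n f id t" using t(1) main by (simp add: minor_word_def)
  then show "\<exists>t. minor_word U n f id t" by blast
qed

lemma (in zero_union) is_ideal_T: "is_ideal (carrier T) U"
  unfolding is_ideal_def subsemigroup_def
proof (intro conjI ballI)
  show "carrier (U\<lparr>carrier := carrier T\<rparr>) \<noteq> {}" by simp
  have cl: "x \<odot>\<^bsub>U\<^esub> y \<in> carrier T" if "x \<in> carrier T \<or> y \<in> carrier T" "x \<in> carrier U" "y \<in> carrier U" for x y
  proof (cases "x \<in> carrier S \<and> y \<in> carrier S")
    case True
    then have "x = z \<or> y = z" using that(1) in_both by auto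
    then show ?thesis using True by (auto simp: mult_U_S)
  next
    case False
    then show ?thesis by (auto simp: mult_U mult_closed)
  qed
  show "s \<odot>\<^bsub>U\<^esub> i \<in> carrier T" "i \<odot>\<^bsub>U\<^esub> s \<in> carrier T" if "i \<in> carrier T" "s \<in> carrier U" for i s
    using cl that by (auto simp: carrier_U)
  fix x y assume "x \<in> carrier (U\<lparr>carrier := carrier T\<rparr>)" "y \<in> carrier (U\<lparr>carrier := carrier T\<rparr>)"
  then show "x \<odot>\<^bsub>U\<^esub> y \<in> carrier (U\<lparr>carrier := carrier T\<rparr>)" using cl[of x y] by (simp add: carrier_U)
qed (auto simp: carrier_U)

lemma (in zero_union) subsemigroup_S: "subsemigroup S U"
  unfolding subsemigroup_def using mult_closed(1) by (auto simp: carrier_U mult_U_S)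

text \<open>Every class of the Rees congruence contains exactly one element of \<open>S\<close>, the class \<open>T\<close> containing the
  zero.\<close>

lemma (in zero_union) rees_quotient_iso:
  "semigroup_isomorphic S (rees_quotient U (carrier T))"
proof -
  let ?r = "rees_congruence U (carrier T)"
  have r: "congruence U ?r" by (rule congruence_rees[OF is_semigroup_U is_ideal_T])
  then have eq: "equiv (carrier U) ?r" by (simp add: congruence_def)
  have cls: "?r `` {x} = ?r `` {y} \<longleftrightarrow> (x, y) \<in> ?r" if "x \<in> carrier U" "y \<in> carrier U" for x y
    using eq_equiv_class_iff[OF eq that] .
  have bij: "bij_betw (\<lambda>x. ?r `` {x}) (carrier S) (carrier (rees_quotient U (carrier T)))"
    unfolding bij_betw_def
  proof
    show "inj_on (\<lambda>x. ?r `` {x}) (carrier S)"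
    proof (rule inj_onI)
      fix x y assume xy: "x \<in> carrier S" "y \<in> carrier S" "?r `` {x} = ?r `` {y}"
      then have "(x, y) \<in> ?r" using cls by (simp add: carrier_U)
      then show "x = y" using in_both[of x] in_both[of y] xy(1,2) by (auto simp: rees_congruence_mem)
    qed
    have "?r `` {x} \<in> (\<lambda>x. ?r `` {x}) ` carrier S" if "x \<in> carrier U" for x
    proof (cases "x \<in> carrier S")
      case False
      then have "?r `` {x} = ?r `` {z}" using that by (subst cls) (auto simp: carrier_U rees_congruence_mem)
      then show ?thesis by simp
    qed simp
    then show "(\<lambda>x. ?r `` {x}) ` carrier S = carrier (rees_quotient U (carrier T))"
      by (auto simp: rees_quotient_def quotient_semigroup_def quotient_def carrier_U)
  qed
  have "(\<lambda>x. ?r `` {x}) \<in> semigroup_iso S (rees_quotient U (carrier T))"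
    unfolding semigroup_iso_def
    using bij by (auto simp: rees_quotient_def quotient_mult[OF r] carrier_U mult_U_S)
  then show ?thesis
    using sgS is_semigroup_quotient[OF is_semigroup_U r]
    by (auto simp: semigroup_isomorphic_def rees_quotient_def)
qed

section \<open>Intervals around a cycle\<close>

text \<open>Continues a word in which \<open>p\<close> has occurred once: the next letter is opened just before \<open>p\<close> is closed.
  Hence \<open>braid [p, q, r, s]\<close> is \<open>p q p r q s r s\<close>, in which consecutive letters overlap and all other
  pairs are disjoint.\<close>

fun chain :: "'b \<Rightarrow> 'b list \<Rightarrow> 'b list" where
  "chain p [] = [p]"
| "chain p (q # r) = q # p # chain q r"

fun braid :: "'b list \<Rightarrow> 'b list" where
  "braid [] = []"
| "braid (p # r) = p # chain p r"

lemma set_chain: "set (chain p r) = insert p (set r)"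
  by (induction r arbitrary: p) auto

lemma set_braid: "set (braid xs) = set xs"
  by (cases xs) (auto simp: set_chain)

lemma filter_chain_head: "p \<notin> set r \<Longrightarrow> filter (\<lambda>c. c = p) (chain p r) = [p]"
  by (induction r arbitrary: p) (auto simp: filter_empty_conv set_chain)

lemma filter_chain_tail:
  "distinct r \<Longrightarrow> x \<in> set r \<Longrightarrow> x \<noteq> p \<Longrightarrow> filter (\<lambda>c. c = x) (chain p r) = [x, x]"
  by (induction r arbitrary: p) (auto simp: filter_chain_head)

lemma filter_braid_drop_head: "p \<notin> K \<Longrightarrow> filter (\<lambda>c. c \<in> K) (braid (p # r)) = filter (\<lambda>c. c \<in> K) (braid r)"
  by (cases r) auto

lemma filter_braid_letter:
  "distinct xs \<Longrightarrow> x \<in> set xs \<Longrightarrow> filter (\<lambda>c. c \<in> {x}) (braid xs) = [x, x]"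
  by (cases xs) (auto simp: filter_chain_head filter_chain_tail)

lemma filter_chain_pair:
  assumes "distinct (p # r)" "i < length r"
  shows "filter (\<lambda>c. c \<in> {p, r ! i}) (chain p r) =
    (if i = 0 then [r ! i, p, r ! i] else [p, r ! i, r ! i])"
proof (cases r)
  case (Cons q r')
  have p: "p \<notin> set (chain q r')" using assms Cons by (auto simp: set_chain)
  have f: "filter (\<lambda>c. c \<in> {p, x}) (chain q r') = filter (\<lambda>c. c = x) (chain q r')" for x
    using p by (intro filter_cong) auto
  show ?thesis
  proof (cases i)
    case 0
    then show ?thesis using f[of q] assms Cons by (auto simp: filter_chain_head)
  next
    case (Suc i')
    then have "r' ! i' \<in> set r'" using assms Cons by auto
    then show ?thesis using f[of "r' ! i'"] assms Cons Suc
      by (auto simp: filter_chain_tail)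
  qed
qed (use assms in auto)

lemma filter_braid_pair:
  assumes "distinct xs" "i < j" "j < length xs"
  shows "filter (\<lambda>c. c \<in> {xs ! i, xs ! j}) (braid xs) =
    (if j = Suc i then [xs ! i, xs ! j, xs ! i, xs ! j] else [xs ! i, xs ! i, xs ! j, xs ! j])"
  using assms
proof (induction xs arbitrary: i j)
  case (Cons p r)
  obtain j' where j: "j = Suc j'" "j' < length r" using Cons.prems by (cases j) auto
  show ?case
  proof (cases i)
    case 0
    then show ?thesis using filter_chain_pair[of p r j'] Cons.prems j by simp
  next
    case (Suc i')
    have "p \<notin> {r ! i', r ! j'}" using Cons.prems Suc j by auto
    then show ?thesis
      using Cons.IH[of i' j'] Cons.prems Suc j filter_braid_drop_head[of p "{r ! i', r ! j'}" r] by simp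
  qed
qed simp

text \<open>Neighbourhood in the cycle on the vertices \<open>0, \<dots>, n - 1\<close>.\<close>

definition adjacent :: "nat \<Rightarrow> nat \<Rightarrow> nat \<Rightarrow> bool" where
  "adjacent n i j \<longleftrightarrow> Suc i = j \<or> Suc j = i \<or> i = 0 \<and> Suc j = n \<or> j = 0 \<and> Suc i = n"

lemma adjacent_sym: "adjacent n i j \<longleftrightarrow> adjacent n j i"
  by (auto simp: adjacent_def)

text \<open>The path that remains of the cycle after removal of the vertex \<open>i\<close>.\<close>

definition cut :: "nat \<Rightarrow> nat \<Rightarrow> nat list" where
  "cut n i = [Suc i..<n] @ [0..<i]"

lemma distinct_cut: "distinct (cut n i)"
  by (auto simp: cut_def)

lemma set_cut: "i < n \<Longrightarrow> set (cut n i) = {..<n} - {i}"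
  by (auto simp: cut_def)

lemma adjacent_cut:
  assumes "i < n" "a < b" "b < length (cut n i)"
  shows "adjacent n (cut n i ! a) (cut n i ! b) \<longleftrightarrow> b = Suc a"
  using assms by (auto simp: adjacent_def cut_def nth_append)

text \<open>The product assigned to arguments that differ from 1 exactly at the places in \<open>P\<close>. For more than two
  places it is zero, and any word in which all of them occur twice will do.\<close>

definition cycle_word :: "nat \<Rightarrow> nat set \<Rightarrow> nat list" where
  "cycle_word n P = (if card P = 2 \<and> adjacent n (Min P) (Max P)
     then [Min P, Max P, Min P, Max P] else concat (map (\<lambda>i. [i, i]) (sorted_list_of_set P)))"

lemma cycle_word_empty: "cycle_word n {} = []"
  by (simp add: cycle_word_def)

lemma cycle_word_singleton: "cycle_word n {i} = [i, i]"
  by (simp add: cycle_word_def)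

lemma cycle_word_pair:
  assumes "i < j"
  shows "cycle_word n {i, j} = (if adjacent n i j then [i, j, i, j] else [i, i, j, j])"
proof -
  have "Min {i, j} = i" "Max {i, j} = j" "card {i, j} = 2" "sorted_list_of_set {i, j} = [i, j]"
    using assms by auto
  then show ?thesis by (simp add: cycle_word_def)
qed

lemma length_cycle_word:
  assumes "finite P"
  shows "length (cycle_word n P) = 2 * card P" "set (cycle_word n P) = P"
proof -
  have "length (concat (map (\<lambda>i. [i, i]) w)) = 2 * length w" for w :: "nat list"
    by (induction w) auto
  then show "length (cycle_word n P) = 2 * card P"
    using assms by (simp add: cycle_word_def)
  show "set (cycle_word n P) = P"
  proof (cases "card P = 2")
    case True
    then obtain i j where "P = {i, j}" "i \<noteq> j" by (auto simp: card_2_iff)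
    then show ?thesis
      using cycle_word_pair[of i j n] cycle_word_pair[of j i n]
      by (cases "i < j") (auto simp: insert_commute)
  next
    case False
    then show ?thesis using assms by (auto simp: cycle_word_def)
  qed
qed

lemma theta_eq_refl: "theta_eq x x"
  by (simp add: theta_eq_def nil_eq_def)

lemma theta_eq_long: "5 \<le> length x \<Longrightarrow> 5 \<le> length y \<Longrightarrow> theta_eq x y"
  by (simp add: theta_eq_def nil_eq_def)

text \<open>For single letters this is what \<open>\<theta>\<close> identifies; all longer values are zero.\<close>

lemma theta_eq_swap:
  assumes "x \<noteq> []" "y \<noteq> []"
  shows "theta_eq (x @ y @ x @ y) (y @ x @ y @ x)" "theta_eq (x @ x @ y @ y) (y @ y @ x @ x)"
proof -
  have "theta_eq (x @ y @ x @ y) (y @ x @ y @ x) \<and> theta_eq (x @ x @ y @ y) (y @ y @ x @ x)"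
  proof (cases "length x = 1 \<and> length y = 1")
    case True
    then obtain c d where "x = [c]" "y = [d]" by (auto simp: length_Suc_conv)
    then show ?thesis by (cases c; cases d) (simp_all add: theta_eq_def nil_eq_def)
  next
    case False
    have "length x \<noteq> 0" "length y \<noteq> 0" using assms by auto
    then have "3 \<le> length x + length y" using False by linarith
    then show ?thesis by (intro conjI theta_eq_long) auto
  qed
  then show "theta_eq (x @ y @ x @ y) (y @ x @ y @ x)" "theta_eq (x @ x @ y @ y) (y @ y @ x @ x)"
    by auto
qed

lemma length_filter_braid:
  assumes "distinct xs" "finite P" "P \<subseteq> set xs"
  shows "length (filter (\<lambda>c. c \<in> P) (braid xs)) = 2 * card P"
proof -
  have "length (filter (\<lambda>c. c \<in> P) (braid xs)) = (\<Sum>i\<in>P. length (filter (\<lambda>j. j \<in> {i}) (braid xs)))"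
    by (rule length_filter_eq_sum[OF assms(2)])
  also have "\<dots> = (\<Sum>i\<in>P. 2)"
    using assms by (intro sum.cong refl, subst filter_braid_letter) auto
  finally show ?thesis by simp
qed

lemma concat_map_filter_support:
  "set w \<subseteq> {..<n} \<Longrightarrow> concat (map y w) = concat (map y (filter (\<lambda>i. i \<in> {i. i < n \<and> y i \<noteq> []}) w))"
  by (rule concat_map_filter) auto

text \<open>If the argument at \<open>i\<close> is 1, the cycle may be replaced by the path that avoids \<open>i\<close>. The order in which
  the path visits two vertices need not be their natural order, which is why symmetry under \<open>\<theta>\<close> is
  needed.\<close>

lemma cycle_word_cut:
  fixes y :: "nat \<Rightarrow> bool list"
  assumes i: "i < n" "y i = []" and P: "P = {k. k < n \<and> y k \<noteq> []}"
  shows "theta_eq (concat (map y (cycle_word n P))) (concat (map y (braid (cut n i))))"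
proof -
  let ?w = "braid (cut n i)"
  have fin: "finite P" by (simp add: P)
  have sub: "P \<subseteq> set (cut n i)" using i by (auto simp: P set_cut)
  have w: "concat (map y ?w) = concat (map y (filter (\<lambda>c. c \<in> P) ?w))"
    unfolding P by (rule concat_map_filter_support) (use i in \<open>auto simp: set_braid set_cut\<close>)
  consider "card P = 0" | "card P = 1" | "card P = 2" | "3 \<le> card P" by linarith
  then show ?thesis
  proof cases
    case 1
    then have "P = {}" using fin by simp
    then show ?thesis unfolding w by (simp add: cycle_word_empty theta_eq_refl)
  next
    case 2
    then obtain p where p: "P = {p}" by (auto simp: card_1_singleton_iff)
    then have "filter (\<lambda>c. c \<in> P) ?w = [p, p]"
      using sub filter_braid_letter[OF distinct_cut, of p n i] by simp
    then show ?thesis unfolding w by (simp add: p cycle_word_singleton theta_eq_refl)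
  next
    case 3
    then obtain p q where pq: "P = {p, q}" "p \<noteq> q" by (auto simp: card_2_iff)
    obtain a b where ab: "a < length (cut n i)" "b < length (cut n i)" "p = cut n i ! a" "q = cut n i ! b"
      using sub pq(1) by (auto simp: in_set_conv_nth)
    obtain c d where cd: "c < d" "d < length (cut n i)" "P = {cut n i ! c, cut n i ! d}"
    proof (cases "a < b")
      case True
      then show ?thesis using that[of a b] ab pq by auto
    next
      case False
      then have "b < a" using ab pq by (metis linorder_neqE_nat)
      then show ?thesis using that[of b a] ab pq by auto
    qed
    define s t where "s = cut n i ! c" and "t = cut n i ! d"
    have st: "P = {s, t}" "s \<noteq> t"
      using cd distinct_cut[of n i] by (auto simp: s_def t_def nth_eq_iff_index_eq)
    have y: "y s \<noteq> []" "y t \<noteq> []" using st(1) P by auto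
    have f: "filter (\<lambda>c. c \<in> P) ?w = (if adjacent n s t then [s, t, s, t] else [s, s, t, t])"
      using filter_braid_pair[OF distinct_cut cd(1,2)] adjacent_cut[OF i(1) cd(1,2)] cd(3)
      by (simp add: s_def t_def)
    have wf: "concat (map y ?w) = (if adjacent n s t then y s @ y t @ y s @ y t else y s @ y s @ y t @ y t)"
      unfolding w f by simp
    show ?thesis
    proof (cases "s < t")
      case True
      then show ?thesis unfolding wf st(1) cycle_word_pair[OF True] by (simp add: theta_eq_refl)
    next
      case False
      then have "t < s" using st(2) by simp
      have "P = {t, s}" using st(1) by auto
      show ?thesis
        unfolding wf \<open>P = {t, s}\<close> cycle_word_pair[OF \<open>t < s\<close>]
        using theta_eq_swap[OF y(2,1)] adjacent_sym[of n s t] by auto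
    qed
  next
    case 4
    have "\<And>c. c \<in> P \<Longrightarrow> y c \<noteq> []" by (auto simp: P)
    then have "length (cycle_word n P) \<le> length (concat (map y (cycle_word n P)))"
      "length (filter (\<lambda>c. c \<in> P) ?w) \<le> length (concat (map y (filter (\<lambda>c. c \<in> P) ?w)))"
      using length_cycle_word(2)[OF fin] by (auto intro!: length_le_concat_map)
    then show ?thesis
      unfolding w using 4 length_cycle_word(1)[OF fin] length_filter_braid[OF distinct_cut fin sub]
      by (intro theta_eq_long) auto
  qed
qed

text \<open>Let the arguments at \<open>i\<close> and \<open>j\<close> be equal. If they are 1, the cycle is cut at \<open>i\<close>. Otherwise they
  contribute four factors, and the value is zero unless all other arguments are 1, in which case it is
  the fourth power no matter how \<open>i\<close> and \<open>j\<close> are interleaved. The term with \<open>i\<close> moved to the front has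
  the same values in both cases.\<close>

lemma cycle_word_minor:
  fixes y :: "nat \<Rightarrow> bool list"
  assumes ij: "i < n" "j < n" "i \<noteq> j" "y i = y j" and P: "P = {k. k < n \<and> y k \<noteq> []}"
  shows "theta_eq (concat (map y (cycle_word n P))) (concat (map y ([i, i] @ braid (cut n i))))"
proof (cases "y i = []")
  case True
  then show ?thesis using cycle_word_cut[OF ij(1) True P] by simp
next
  case False
  let ?w = "braid (cut n i)"
  have fin: "finite P" by (simp add: P)
  have mem: "i \<in> P" "j \<in> P" using ij False by (auto simp: P)
  have sub: "P - {i} \<subseteq> set (cut n i)" using ij by (auto simp: P set_cut)
  have "filter (\<lambda>c. c \<in> P) ?w = filter (\<lambda>c. c \<in> P - {i}) ?w"
    by (rule filter_cong) (use ij in \<open>auto simp: set_braid set_cut\<close>)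
  then have w: "concat (map y ?w) = concat (map y (filter (\<lambda>c. c \<in> P - {i}) ?w))"
    using concat_map_filter_support[of ?w n y] ij by (auto simp: set_braid set_cut P)
  show ?thesis
  proof (cases "P = {i, j}")
    case P_pair: True
    then have "P - {i} = {j}" using ij by auto
    then have "concat (map y ?w) = y j @ y j"
      unfolding w using sub filter_braid_letter[OF distinct_cut, of j n i] by simp
    moreover have "concat (map y (cycle_word n P)) = y j @ y j @ y j @ y j"
    proof (cases "i < j")
      case True
      then show ?thesis using P_pair ij(4) by (simp add: cycle_word_pair)
    next
      case False
      then have "j < i" "P = {j, i}" using ij P_pair by auto
      then show ?thesis using ij(4) by (simp add: cycle_word_pair)
    qed
    ultimately show ?thesis using ij(4) by (simp add: theta_eq_refl)
  next
    case False
    then have "{i, j} \<subset> P" using mem by auto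
    then have "card {i, j} < card P" by (rule psubset_card_mono[OF fin])
    then have card: "3 \<le> card P" "2 \<le> card (P - {i})" using ij mem by auto
    have ne: "\<And>c. c \<in> P \<Longrightarrow> y c \<noteq> []" by (auto simp: P)
    then have "length (cycle_word n P) \<le> length (concat (map y (cycle_word n P)))"
      using length_cycle_word(2)[OF fin] by (auto intro!: length_le_concat_map)
    then have 1: "5 \<le> length (concat (map y (cycle_word n P)))"
      using card length_cycle_word(1)[OF fin] by simp
    have "length (filter (\<lambda>c. c \<in> P - {i}) ?w) \<le> length (concat (map y ?w))"
      unfolding w using ne by (auto intro!: length_le_concat_map)
    then have "4 \<le> length (concat (map y ?w))"
      using card length_filter_braid[OF distinct_cut _ sub] fin by simp
    moreover have "1 \<le> length (y i)" using \<open>y i \<noteq> []\<close> by (simp add: Suc_le_eq)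
    ultimately have "5 \<le> length (concat (map y ([i, i] @ ?w)))" by simp
    then show ?thesis using 1 by (rule theta_eq_long[rotated])
  qed
qed

text \<open>The values do not depend on the choice of words for the arguments, but fixing a choice by \<open>inv v\<close>
  gives equal words for equal arguments.\<close>

definition cycle_fun :: "'s semigrp \<Rightarrow> (bool list \<Rightarrow> 's) \<Rightarrow> nat \<Rightarrow> 's list \<Rightarrow> 's" where
  "cycle_fun S v n = restrict (\<lambda>x. let y = (\<lambda>i. inv v (x ! i)) in
     v (concat (map y (cycle_word n {i. i < n \<and> y i \<noteq> []})))) (tuples n (carrier S))"

lemma filter_distinct_pair:
  assumes "distinct xs" "u \<in> set xs" "w \<in> set xs" "u \<noteq> w"
  shows "filter (\<lambda>c. c \<in> {u, w}) xs \<in> {[u, w], [w, u]}"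
proof -
  let ?l = "filter (\<lambda>c. c \<in> {u, w}) xs"
  have d: "distinct ?l" "set ?l = {u, w}" using assms by auto
  then have "length ?l = 2" using distinct_card[of ?l] assms(4) by simp
  then obtain c e where "?l = [c, e]" by (auto simp: length_Suc_conv numeral_2_eq_2)
  then show ?thesis using d by (auto simp: doubleton_eq_iff)
qed

lemma filter_distinct_single:
  assumes "distinct xs" "u \<in> set xs" "w \<notin> set xs"
  shows "filter (\<lambda>c. c \<in> {u, w}) xs = [u]"
proof -
  let ?l = "filter (\<lambda>c. c \<in> {u, w}) xs"
  have d: "distinct ?l" "set ?l = {u}" using assms by auto
  then have "length ?l = 1" using distinct_card[of ?l] by simp
  then obtain c where "?l = [c]" by (auto simp: length_Suc_conv)
  then show ?thesis using d by auto
qed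

text \<open>Consider the letter \<open>p\<close> whose second occurrence comes first. Both its neighbours in the cycle have
  occurred before that point, as their intervals overlap that of \<open>p\<close>, and neither has occurred twice.
  So the intervals of the two neighbours overlap, too.\<close>

lemma no_cycle_word:
  assumes n: "4 \<le> n"
    and adj: "\<And>p q. p < n \<Longrightarrow> q < n \<Longrightarrow> p \<noteq> q \<Longrightarrow> adjacent n p q \<Longrightarrow>
       filter (\<lambda>c. c \<in> {p, q}) t \<in> {[p, q, p, q], [q, p, q, p]}"
    and nadj: "\<And>p q. p < n \<Longrightarrow> q < n \<Longrightarrow> p \<noteq> q \<Longrightarrow> \<not> adjacent n p q \<Longrightarrow>
       filter (\<lambda>c. c \<in> {p, q}) t \<in> {[p, p, q, q], [q, q, p, p]}"
    and t: "set t \<subseteq> {..<n}"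
  shows False
proof -
  have "\<not> distinct (filter (\<lambda>c. c \<in> {0, 1}) t)"
    using adj[of 0 1] n by (auto simp: adjacent_def)
  then have "\<not> distinct t" using distinct_filter by blast
  then obtain xs p ys where split: "t = xs @ p # ys" "p \<in> set xs" "distinct xs"
    using not_distinct_conv_prefix by metis
  have p: "p < n" using t split(1) by auto
  define q where "q = (if Suc p = n then 0 else Suc p)"
  define r where "r = (if p = 0 then n - 1 else p - 1)"
  \<comment> \<open>For \<open>n = 3\<close> the two neighbours of \<open>p\<close> would be adjacent.\<close>
  have qr: "q < n" "r < n" "q \<noteq> p" "r \<noteq> p" "q \<noteq> r" "adjacent n p q" "adjacent n p r" "\<not> adjacent n q r"
    using p n by (auto simp: q_def r_def adjacent_def split: if_splits)
  have opened: "s \<in> set xs" if s: "s < n" "s \<noteq> p" "adjacent n p s" for s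
  proof (rule ccontr)
    assume "s \<notin> set xs"
    then have "filter (\<lambda>c. c \<in> {p, s}) xs = [p]" by (rule filter_distinct_single[OF split(3,2)])
    then have "filter (\<lambda>c. c \<in> {p, s}) t = p # p # filter (\<lambda>c. c \<in> {p, s}) ys" unfolding split(1) by simp
    then show False using adj[of p s] p s by auto
  qed
  have "filter (\<lambda>c. c \<in> {q, r}) xs \<in> {[q, r], [r, q]}"
    by (rule filter_distinct_pair[OF split(3)]) (use opened qr in auto)
  moreover have "filter (\<lambda>c. c \<in> {q, r}) t = filter (\<lambda>c. c \<in> {q, r}) xs @ filter (\<lambda>c. c \<in> {q, r}) ys"
    unfolding split(1) using qr by simp
  ultimately show False using nadj[of q r] qr by auto
qed

lemma theta_eq_four:
  "length x = 4 \<Longrightarrow> theta_eq x y \<Longrightarrow> y = x \<or> y = map Not x"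
  by (auto simp: theta_eq_def nil_eq_def)

lemma theta_eq_short: "theta_eq x y \<Longrightarrow> length y \<le> 1 \<Longrightarrow> x = y"
  by (auto simp: theta_eq_def nil_eq_def)

text \<open>By \<open>cycle_word_minor\<close>, \<open>cycle_fun\<close> is a term function whenever two arguments are equal. If it were
  a term function altogether, substituting the two generators for two variables and 1 for the others
  would show that the word is one excluded by \<open>no_cycle_word\<close>.\<close>

lemma not_finitely_related_theta:
  assumes S: "presented S theta_eq v" and fin: "finite (carrier S)"
  shows "\<not> finitely_related S"
proof
  assume "finitely_related S"
  let ?C = "carrier S"
  obtain N where N: "\<forall>n\<ge>N. \<forall>f \<in> tuples n ?C \<rightarrow>\<^sub>E ?C.
    (\<forall>i<n. \<forall>j<n. i \<noteq> j \<longrightarrow> (\<exists>t. t \<noteq> [] \<and> set t \<subseteq> {..<n} \<and>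
        (\<forall>x\<in>tuples n ?C. x ! i = x ! j \<longrightarrow> f x = term_function S n t x))) \<longrightarrow>
    f \<in> term_functions S n"
    using finitely_related_arity_bound[OF \<open>finitely_related S\<close> fin] by (elim exE)
  define n where "n = max N 4"
  let ?f = "cycle_fun S v n"
  note D = presentedD[OF S]
  have v_inv: "v (inv v x) = x" if "x \<in> ?C" for x using that D(1) by (simp add: f_inv_into_f)
  have term_eq: "term_function S n t x = v (concat (map (\<lambda>i. inv v (x ! i)) t))"
    if x: "x \<in> tuples n ?C" and t: "t \<noteq> []" "set t \<subseteq> {..<n}" for x t
  proof -
    have "map (\<lambda>i. x ! i) t = map (\<lambda>i. v (inv v (x ! i))) t"
      using nth_mem_carrier[OF x] t(2) v_inv by (intro map_cong) auto
    then show ?thesis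
      unfolding term_function_apply[OF x] by (simp only: word_product_presented[OF S t(1)])
  qed
  have "?f \<in> term_functions S n"
  proof (rule N[THEN spec, THEN mp, THEN bspec, THEN mp])
    show "N \<le> n" by (simp add: n_def)
    show "?f \<in> tuples n ?C \<rightarrow>\<^sub>E ?C" by (auto simp: cycle_fun_def Let_def D(1))
    show "\<forall>i<n. \<forall>j<n. i \<noteq> j \<longrightarrow> (\<exists>t. t \<noteq> [] \<and> set t \<subseteq> {..<n} \<and>
        (\<forall>x\<in>tuples n ?C. x ! i = x ! j \<longrightarrow> ?f x = term_function S n t x))"
    proof (intro allI impI)
      fix i j assume ij: "i < n" "j < n" "i \<noteq> j"
      let ?t = "[i, i] @ braid (cut n i)"
      have t: "?t \<noteq> []" "set ?t \<subseteq> {..<n}" using ij by (auto simp: set_braid set_cut)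
      have "?f x = term_function S n ?t x" if x: "x \<in> tuples n ?C" "x ! i = x ! j" for x
        unfolding term_eq[OF x(1) t]
        using cycle_word_minor[OF ij, of "\<lambda>i. inv v (x ! i)"] x
        by (simp add: cycle_fun_def Let_def D(3))
      then show "\<exists>t. t \<noteq> [] \<and> set t \<subseteq> {..<n} \<and>
        (\<forall>x\<in>tuples n ?C. x ! i = x ! j \<longrightarrow> ?f x = term_function S n t x)" using t by blast
    qed
  qed
  then obtain t where t: "t \<noteq> []" "set t \<subseteq> {..<n}" "?f = term_function S n t"
    by (auto simp: term_functions_def)
  have eval: "theta_eq (concat (map y (cycle_word n {i. i < n \<and> y i \<noteq> []}))) (concat (map y t))"
    if y: "\<And>i. length (y i) \<le> 1" for y
  proof -
    let ?x = "map (\<lambda>i. v (y i)) [0..<n]"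
    have x: "?x \<in> tuples n ?C" by (rule map_upt_tuples) (auto simp: D(1))
    \<comment> \<open>Words of length at most 1 are alone in their classes, so the chosen words are the given ones.\<close>
    have inv: "inv v (?x ! i) = y i" if "i < n" for i
    proof (rule theta_eq_short[OF _ y])
      have "v (inv v (v (y i))) = v (y i)" by (rule v_inv) (auto simp: D(1))
      then show "theta_eq (inv v (?x ! i)) (y i)" using that by (simp add: D(3))
    qed
    let ?P = "{i. i < n \<and> y i \<noteq> []}"
    have P: "{i. i < n \<and> inv v (?x ! i) \<noteq> []} = ?P"
      by (intro Collect_cong conj_cong refl) (simp only: inv)
    have "?f ?x = v (concat (map (\<lambda>i. inv v (?x ! i)) (cycle_word n ?P)))"
      using x by (simp only: cycle_fun_def Let_def restrict_apply P if_True)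
    also have "map (\<lambda>i. inv v (?x ! i)) (cycle_word n ?P) = map y (cycle_word n ?P)"
      using length_cycle_word(2)[of ?P n] inv by (intro map_cong) auto
    finally have "?f ?x = v (concat (map y (cycle_word n ?P)))" .
    moreover have "?f ?x = v (concat (map (\<lambda>i. inv v (?x ! i)) t))"
      unfolding t(3) by (rule term_eq[OF x t(1,2)])
    moreover have "map (\<lambda>i. inv v (?x ! i)) t = map y t" using t(2) inv by (intro map_cong) auto
    ultimately show ?thesis by (simp add: D(3)[symmetric])
  qed
  have pair: "filter (\<lambda>c. c \<in> {p, q}) t \<in>
      (if adjacent n p q then {[p, q, p, q], [q, p, q, p]} else {[p, p, q, q], [q, q, p, p]})"
    if pq: "p < q" "q < n" for p q
  proof -
    define y where "y i = (if i = p then [True] else if i = q then [False] else [])" for i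
    have "concat (map y w) = map (\<lambda>c. c = p) (filter (\<lambda>c. c \<in> {p, q}) w)" for w
      by (induction w) (auto simp: y_def)
    moreover have "{i. i < n \<and> y i \<noteq> []} = {p, q}" using pq by (auto simp: y_def)
    ultimately have "theta_eq (map (\<lambda>c. c = p) (filter (\<lambda>c. c \<in> {p, q}) (cycle_word n {p, q})))
        (map (\<lambda>c. c = p) (filter (\<lambda>c. c \<in> {p, q}) t))"
      using eval[of y] by (simp add: y_def)
    then have "theta_eq (if adjacent n p q then [True, False, True, False] else [True, True, False, False])
        (map (\<lambda>c. c = p) (filter (\<lambda>c. c \<in> {p, q}) t))"
      using pq by (simp add: cycle_word_pair split: if_splits)
    then have "map (\<lambda>c. c = p) (filter (\<lambda>c. c \<in> {p, q}) t) \<in>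
      (if adjacent n p q then {[True, False, True, False], [False, True, False, True]}
       else {[True, True, False, False], [False, False, True, True]})"
      by (cases "adjacent n p q") (auto dest!: theta_eq_four[rotated])
    then have "map (\<lambda>b. if b then p else q) (map (\<lambda>c. c = p) (filter (\<lambda>c. c \<in> {p, q}) t)) \<in>
      (if adjacent n p q then {[p, q, p, q], [q, p, q, p]} else {[p, p, q, q], [q, q, p, p]})"
      by (auto split: if_splits)
    moreover have "map (\<lambda>b. if b then p else q) (map (\<lambda>c. c = p) (filter (\<lambda>c. c \<in> {p, q}) t)) =
        filter (\<lambda>c. c \<in> {p, q}) t"
      unfolding map_map by (rule map_idI) auto
    ultimately show ?thesis by simp
  qed
  have both: "filter (\<lambda>c. c \<in> {p, q}) t \<in>
      (if adjacent n p q then {[p, q, p, q], [q, p, q, p]} else {[p, p, q, q], [q, q, p, p]})"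
    if pq: "p \<noteq> q" "p < n" "q < n" for p q
  proof (cases "p < q")
    case True
    then show ?thesis using pair pq by blast
  next
    case False
    then have "q < p" using pq by simp
    then show ?thesis using pair[of q p] pq adjacent_sym[of n p q] by (auto simp: insert_commute)
  qed
  show False
  proof (rule no_cycle_word[of n t])
    show "4 \<le> n" by (simp add: n_def)
    show "filter (\<lambda>c. c \<in> {p, q}) t \<in> {[p, q, p, q], [q, p, q, p]}"
      if "p < n" "q < n" "p \<noteq> q" "adjacent n p q" for p q using both[of p q] that by simp
    show "filter (\<lambda>c. c \<in> {p, q}) t \<in> {[p, p, q, q], [q, q, p, p]}"
      if "p < n" "q < n" "p \<noteq> q" "\<not> adjacent n p q" for p q using both[of p q] that by simp
  qed (rule t(2))
qed

section \<open>The zero-direct union and its Rees quotient\<close>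

theorem lemma3p14:
  fixes a b :: 'a
    and S T :: "'a list set set option semigrp"
    and z :: "'a list set set option"
  assumes "a \<noteq> b"
    and "S = adjoin_one (quotient_semigroup (free_nilpotent 5 {a, b}) (theta a b))"
    and "semigroup_isomorphic T (adjoin_one (free_nilpotent 5 {a, b}))"
    and "is_zero S z" and "is_zero T z"
    and "carrier S \<inter> carrier T = {z}"
  shows "finitely_related (zero_direct_union z S T) \<and>
         subsemigroup S (zero_direct_union z S T) \<and>
         (\<exists>I. is_ideal I (zero_direct_union z S T) \<and>
              semigroup_isomorphic S (rees_quotient (zero_direct_union z S T) I)) \<and>
         \<not> finitely_related S"
proof -
  let ?vS = "\<lambda>w. if w = [] then None else Some (theta a b `` {nil_class 5 {a, b} (map (letter a b) w)})"
  let ?vN = "\<lambda>w. if w = [] then None else Some (nil_class 5 {a, b} (map (letter a b) w))"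
  have S: "presented S theta_eq ?vS"
    unfolding assms(2)
    by (rule presented_adjoin_one[OF presented_theta_quotient[OF assms(1)]])
      (auto simp: theta_eq_def nil_eq_def)
  have N: "presented (adjoin_one (free_nilpotent 5 {a, b})) (nil_eq 5) ?vN"
    by (rule presented_adjoin_one[OF presented_free_nilpotent[OF assms(1)]]) (auto simp: nil_eq_def)
  obtain h where h: "h \<in> semigroup_iso T (adjoin_one (free_nilpotent 5 {a, b}))" and sgT: "is_semigroup T"
    using assms(3) by (auto simp: semigroup_isomorphic_def)
  note T = presented_iso[OF h sgT N]
  interpret zero_union S T "zero_direct_union z S T" z
    by unfold_locales (simp_all add: assms(4-6) is_semigroup_presented[OF S] sgT
        is_semigroup.m_closed is_semigroup.m_assoc is_semigroup.nonempty)
  have le: "theta_eq x y" if "nil_eq 5 x y" for x y using that by (simp add: theta_eq_def)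
  have finS: "finite (carrier S)" by (rule finite_presented[OF S le])
  then have "finite (carrier (zero_direct_union z S T))"
    using finite_presented[OF T] by (simp add: carrier_U)
  then show ?thesis
    using finitely_related_U[OF T S le] subsemigroup_S is_ideal_T rees_quotient_iso
      not_finitely_related_theta[OF S finS] by blast
qed

end
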